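(* Let $\mathcal{E}$ be a Dirichlet form in $L^2=L^2(X,m)$ with domain $\mathcal{D}$. Then there are unique quadratic forms $\mathcal{E}^{\mathrm{cons}}$ and $\mathcal{E}^{\mathrm{diss}}$ with respective domains $\mathcal{D}$ (that is, both with domain $\mathcal{D}$) such that (a) the forms $\mathcal{E}^{\mathrm{cons}}$ and $\mathcal{E}^{\mathrm{diss}}$ are Dirichlet forms in the wide sense in $L^2$; (b) the form $\mathcal{E}^{\mathrm{cons}}$ is conservative in $L^2(X_{\mathrm{cons}},m|_{X_{\mathrm{cons}}})$, whereas $\mathcal{E}^{\mathrm{diss}}$ is dissipative in $L^2(X_{\mathrm{diss}},m|_{X_{\mathrm{diss}}})$, and $$\mathcal{E}[u]=\mathcal{E}^{\mathrm{cons}}[u]+\mathcal{E}^{\mathrm{diss}}[u]\qquad\text{for all }u\in\mathcal{D}.$$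
   Context: $X$ is a Hausdorff topological space and $m$ is a positive $\sigma$-finite Radon measure on a $\sigma$-algebra $\mathcal{A}$ of subsets of $X$, with full support $X$; $L^p=L^p(X,m)$. All equalities and inequalities are understood $m$-a.e. A Dirichlet form $\mathcal{E}$ with domain $\mathcal{D}\subset L^2$ is a (symmetric) densely defined closed quadratic form such that $u\in\mathcal{D}$ implies $u_{0,1}:=\min(\max(u,0),1)\in\mathcal{D}$ and $\mathcal{E}[u_{0,1}]\le\mathcal{E}[u]$. A Dirichlet form in the wide sense is a quadratic form with domain in $L^2$ having all these properties except being densely defined. Let $(T_t)_{t>0}$ be the strongly continuous semigroup of Markovian selfadjoint operators on $L^2$ associated with $\mathcal{E}$. It extends to $L^\infty$: choose an increasing sequence $\varphi_k\in L^1\cap L^\infty$ with $0<\varphi_k\le1$, $\varphi_k\uparrow1$; for $0\le u\in L^\infty$ put $T_tu=\lim_kT_t(u\varphi_k)$, and $T_tu=T_tu^+-T_tu^-$ in general. The form $\mathcal{E}$ is called conservative if $T_t1=1$ for some and hence every $t>0$. It is called dissipative if $m(\{T_t1<1\})>0$ for some $t>0$. The same definitions are used for Dirichlet forms in $L^2(Y,m|_Y)$, $Y\subset X$ measurable, with their own semigroup and with $1$ replaced by $1_Y$. Set $X_{\mathrm{cons}}:=\bigcap_{t>0}\{T_t1=1\}=\bigcap_{k\in\mathbb{N}}\{T_k1=1\}$ and $X_{\mathrm{diss}}:=X\setminus X_{\mathrm{cons}}=\bigcup_{k\in\mathbb{N}}\{T_k1<1\}$. Both sets are invariant, where a measurable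 set $Y$ is called invariant if $T_t(1_Yu)=1_YT_tu$ for all $u\in L^2$ and some (any) $t>0$. Convention on parts: for an invariant set $Y$, the part of $\mathcal{E}$ on $Y$ is the quadratic form $\mathcal{E}^Y$ with domain $\mathcal{D}$ and $\mathcal{E}^Y[u]=\mathcal{E}[1_Yu]$; it is regarded both as a Dirichlet form in the wide sense in $L^2$ and as a Dirichlet form in $L^2(Y,m|_Y)$.
   Formalization: Dissipativity of E^diss is claimed only if m(X_diss)>0 (it fails for conservative E); each form Q must satisfy Q[u]=Q[1_Y u], Y its set (else not unique); (a) is meant on the u in D vanishing outside Y, as on all of D closedness can fail. *)

theory Defs
  imports "HOL-Analysis.Analysis"
begin

(* Conventions vary on whether Radon measures are locally finite or merely finite on compact
   sets; the latter, weaker, requirement is used.  The sigma-algebra may be larger than Borel. *)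
definition radon_measure :: "'a::t2_space measure \<Rightarrow> bool" where
  "radon_measure M \<longleftrightarrow>
     space M = UNIV \<and> sets borel \<subseteq> sets M \<and>
     (\<forall>K. compact K \<longrightarrow> emeasure M K < \<infinity>) \<and>
     (\<forall>A\<in>sets M. emeasure M A = (SUP K\<in>{K. compact K \<and> K \<subseteq> A}. emeasure M K))"

definition full_support :: "'a::t2_space measure \<Rightarrow> bool" where
  "full_support M \<longleftrightarrow> (\<forall>U. open U \<and> U \<noteq> {} \<longrightarrow> emeasure M U > 0)"


section \<open>The space L2\<close>

(* Elements of L2 are represented by functions; every notion below that takes such functions
   is required to respect, or does respect, equality almost everywhere. *)
definition L2 :: "'a measure \<Rightarrow> ('a \<Rightarrow> real) set" where
  "L2 M = {u \<in> borel_measurable M. integrable M (\<lambda>x. (u x)\<^sup>2)}"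

definition L2_inner :: "'a measure \<Rightarrow> ('a \<Rightarrow> real) \<Rightarrow> ('a \<Rightarrow> real) \<Rightarrow> real" where
  "L2_inner M u v = (\<integral>x. u x * v x \<partial>M)"

definition L2_norm :: "'a measure \<Rightarrow> ('a \<Rightarrow> real) \<Rightarrow> real" where
  "L2_norm M u = sqrt (L2_inner M u u)"


section \<open>Quadratic forms and Dirichlet forms\<close>

(* A form is a partial function on (representatives of) L2 functions; its domain is dom E. *)
type_synonym 'a form = "('a \<Rightarrow> real) \<Rightarrow> real option"

definition quadratic_form :: "'a measure \<Rightarrow> 'a form \<Rightarrow> bool" where
  "quadratic_form M E \<longleftrightarrow>
     dom E \<subseteq> L2 M \<and>
     (\<forall>u\<in>dom E. \<forall>v\<in>borel_measurable M. (AE x in M. u x = v x) \<longrightarrow> E v = E u) \<and>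
     (\<lambda>_. 0) \<in> dom E \<and>
     (\<forall>u\<in>dom E. \<forall>v\<in>dom E. (\<lambda>x. u x + v x) \<in> dom E) \<and>
     (\<forall>c. \<forall>u\<in>dom E. (\<lambda>x. c * u x) \<in> dom E) \<and>
     (\<exists>a. (\<forall>u\<in>dom E. \<forall>v\<in>dom E. a u v = a v u) \<and>
          (\<forall>u\<in>dom E. \<forall>v\<in>dom E. \<forall>w\<in>dom E. a (\<lambda>x. u x + v x) w = a u w + a v w) \<and>
          (\<forall>c. \<forall>u\<in>dom E. \<forall>v\<in>dom E. a (\<lambda>x. c * u x) v = c * a u v) \<and>
          (\<forall>u\<in>dom E. the (E u) = a u u)) \<and>
     (\<forall>u\<in>dom E. the (E u) \<ge> 0)"

(* The symmetric bilinear form belonging to E, by polarization. *)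
definition polar :: "'a form \<Rightarrow> ('a \<Rightarrow> real) \<Rightarrow> ('a \<Rightarrow> real) \<Rightarrow> real" where
  "polar E u v = (the (E (\<lambda>x. u x + v x)) - the (E (\<lambda>x. u x - v x))) / 4"

definition form_norm :: "'a measure \<Rightarrow> 'a form \<Rightarrow> ('a \<Rightarrow> real) \<Rightarrow> real" where
  "form_norm M E u = sqrt (the (E u) + (L2_norm M u)\<^sup>2)"

definition closed_form :: "'a measure \<Rightarrow> 'a form \<Rightarrow> bool" where
  "closed_form M E \<longleftrightarrow>
     (\<forall>u :: nat \<Rightarrow> 'a \<Rightarrow> real.
        (\<forall>n. u n \<in> dom E) \<and>
        (\<forall>e>0. \<exists>N. \<forall>m\<ge>N. \<forall>n\<ge>N. form_norm M E (\<lambda>x. u m x - u n x) < e) \<longrightarrow>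
        (\<exists>w\<in>dom E. (\<lambda>n. form_norm M E (\<lambda>x. u n x - w x)) \<longlonglongrightarrow> 0))"

definition densely_defined :: "'a measure \<Rightarrow> 'a form \<Rightarrow> bool" where
  "densely_defined M E \<longleftrightarrow> (\<forall>u\<in>L2 M. \<forall>e>0. \<exists>v\<in>dom E. L2_norm M (\<lambda>x. u x - v x) < e)"

definition wide_dirichlet_form :: "'a measure \<Rightarrow> 'a form \<Rightarrow> bool" where
  "wide_dirichlet_form M E \<longleftrightarrow>
     quadratic_form M E \<and> closed_form M E \<and>
     (\<forall>u\<in>dom E. (\<lambda>x. min (max (u x) 0) 1) \<in> dom E \<and>
                the (E (\<lambda>x. min (max (u x) 0) 1)) \<le> the (E u))"

definition dirichlet_form :: "'a measure \<Rightarrow> 'a form \<Rightarrow> bool" where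
  "dirichlet_form M E \<longleftrightarrow> wide_dirichlet_form M E \<and> densely_defined M E"


section \<open>The associated semigroup\<close>

(* Strongly continuous semigroups of Markovian selfadjoint contractions; only the operators T t
   with t > 0, applied to functions in L2, matter. *)
definition markov_semigroup :: "'a measure \<Rightarrow> (real \<Rightarrow> ('a \<Rightarrow> real) \<Rightarrow> ('a \<Rightarrow> real)) \<Rightarrow> bool" where
  "markov_semigroup M T \<longleftrightarrow>
     (\<forall>t>0. \<forall>u\<in>L2 M. T t u \<in> L2 M) \<and>
     (\<forall>t>0. \<forall>u\<in>L2 M. \<forall>v\<in>L2 M. (AE x in M. u x = v x) \<longrightarrow> (AE x in M. T t u x = T t v x)) \<and>
     (\<forall>t>0. \<forall>u\<in>L2 M. \<forall>v\<in>L2 M. AE x in M. T t (\<lambda>y. u y + v y) x = T t u x + T t v x) \<and>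
     (\<forall>t>0. \<forall>c. \<forall>u\<in>L2 M. AE x in M. T t (\<lambda>y. c * u y) x = c * T t u x) \<and>
     (\<forall>t>0. \<forall>u\<in>L2 M. L2_norm M (T t u) \<le> L2_norm M u) \<and>
     (\<forall>t>0. \<forall>u\<in>L2 M. \<forall>v\<in>L2 M. L2_inner M (T t u) v = L2_inner M u (T t v)) \<and>
     (\<forall>s>0. \<forall>t>0. \<forall>u\<in>L2 M. AE x in M. T (s + t) u x = T s (T t u) x) \<and>
     (\<forall>u\<in>L2 M. ((\<lambda>t. L2_norm M (\<lambda>x. T t u x - u x)) \<longlongrightarrow> 0) (at_right 0)) \<and>
     (\<forall>t>0. \<forall>u\<in>L2 M. (AE x in M. 0 \<le> u x \<and> u x \<le> 1) \<longrightarrow>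
        (AE x in M. 0 \<le> T t u x \<and> T t u x \<le> 1))"

(* T is the semigroup exp(-tA), where A is the selfadjoint operator of the form:
   u lies in the domain of A with A u = f iff u is in dom E and E(u,v) = (f,v) for v in dom E.
   The left-hand side of the equivalence says that the generator of T maps u to -f. *)
definition associated_semigroup ::
    "'a measure \<Rightarrow> 'a form \<Rightarrow> (real \<Rightarrow> ('a \<Rightarrow> real) \<Rightarrow> ('a \<Rightarrow> real)) \<Rightarrow> bool" where
  "associated_semigroup M E T \<longleftrightarrow>
     markov_semigroup M T \<and>
     (\<forall>u\<in>L2 M. \<forall>f\<in>L2 M.
        ((\<lambda>t. L2_norm M (\<lambda>x. (u x - T t u x) / t - f x)) \<longlongrightarrow> 0) (at_right 0) \<longleftrightarrow>
        u \<in> dom E \<and> (\<forall>v\<in>dom E. polar E u v = L2_inner M f v))"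

definition exhausting_sequence :: "'a measure \<Rightarrow> (nat \<Rightarrow> 'a \<Rightarrow> real) \<Rightarrow> bool" where
  "exhausting_sequence M \<phi> \<longleftrightarrow>
     (\<forall>k. integrable M (\<phi> k)) \<and>
     (AE x in M. (\<forall>k. 0 < \<phi> k x \<and> \<phi> k x \<le> 1) \<and> incseq (\<lambda>k. \<phi> k x) \<and> (\<lambda>k. \<phi> k x) \<longlonglongrightarrow> 1)"

(* Extension of the semigroup to bounded functions.  The choice of the sequence is immaterial up
   to null sets; the limit exists almost everywhere by monotonicity. *)
definition Linf_extension_nonneg ::
    "'a measure \<Rightarrow> (real \<Rightarrow> ('a \<Rightarrow> real) \<Rightarrow> ('a \<Rightarrow> real)) \<Rightarrow> real \<Rightarrow> ('a \<Rightarrow> real) \<Rightarrow> ('a \<Rightarrow> real)" where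
  "Linf_extension_nonneg M T t u =
     (let \<phi> = (SOME \<phi>. exhausting_sequence M \<phi>) in (\<lambda>x. lim (\<lambda>k. T t (\<lambda>y. u y * \<phi> k y) x)))"

definition Linf_extension ::
    "'a measure \<Rightarrow> (real \<Rightarrow> ('a \<Rightarrow> real) \<Rightarrow> ('a \<Rightarrow> real)) \<Rightarrow> real \<Rightarrow> ('a \<Rightarrow> real) \<Rightarrow> ('a \<Rightarrow> real)" where
  "Linf_extension M T t u =
     (\<lambda>x. Linf_extension_nonneg M T t (\<lambda>y. max (u y) 0) x
        - Linf_extension_nonneg M T t (\<lambda>y. max (- u y) 0) x)"


section \<open>Conservative and dissipative forms\<close>

(* The associated semigroup is unique up to null sets, so the existential quantifier over T
   only names it. *)
definition conservative :: "'a measure \<Rightarrow> 'a form \<Rightarrow> bool" where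
  "conservative M E \<longleftrightarrow>
     (\<exists>T. associated_semigroup M E T \<and>
          (\<forall>t>0. AE x in M. Linf_extension M T t (\<lambda>_. 1) x = 1))"

definition dissipative :: "'a measure \<Rightarrow> 'a form \<Rightarrow> bool" where
  "dissipative M E \<longleftrightarrow>
     (\<exists>T. associated_semigroup M E T \<and>
          (\<exists>t>0. emeasure M {x \<in> space M. Linf_extension M T t (\<lambda>_. 1) x < 1} > 0))"

(* Functions are only determined up to null sets, hence the countable intersection over
   integer times rather than the one over all real times. *)
definition X_cons :: "'a measure \<Rightarrow> (real \<Rightarrow> ('a \<Rightarrow> real) \<Rightarrow> ('a \<Rightarrow> real)) \<Rightarrow> 'a set" where
  "X_cons M T = {x \<in> space M. \<forall>k::nat. k \<ge> 1 \<longrightarrow> Linf_extension M T (real k) (\<lambda>_. 1) x = 1}"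

definition X_diss :: "'a measure \<Rightarrow> (real \<Rightarrow> ('a \<Rightarrow> real) \<Rightarrow> ('a \<Rightarrow> real)) \<Rightarrow> 'a set" where
  "X_diss M T = space M - X_cons M T"


section \<open>Forms on a measurable subset\<close>

definition cut :: "'a set \<Rightarrow> ('a \<Rightarrow> real) \<Rightarrow> ('a \<Rightarrow> real)" where
  "cut Y u = (\<lambda>x. indicat_real Y x * u x)"

(* A form Q with domain D is a form on Y if Q[u] = Q[1_Y u] for all u in D, as is the case for the
   part u |-> E[1_Y u] of a form E on an invariant set Y.  Equality of the option values includes
   that 1_Y u is in D. *)
definition form_on :: "'a set \<Rightarrow> 'a form \<Rightarrow> bool" where
  "form_on Y Q \<longleftrightarrow> (\<forall>u\<in>dom Q. Q (cut Y u) = Q u)"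

(* Such a form Q is regarded as a form in the whole L2 by letting it act on the (in general not
   dense) space {1_Y u | u in D} of those elements of D that vanish outside Y, and as a form in
   L2(Y) by identifying functions on Y with their extensions by zero.  (On all of D the form Q
   is in general not closed, since it does not control u outside Y.) *)
definition as_form_in_L2 :: "'a measure \<Rightarrow> 'a set \<Rightarrow> 'a form \<Rightarrow> 'a form" where
  "as_form_in_L2 M Y Q = Q |` {u. AE x in M. x \<notin> Y \<longrightarrow> u x = 0}"

definition as_form_in_L2_of :: "'a set \<Rightarrow> 'a form \<Rightarrow> 'a form" where
  "as_form_in_L2_of Y Q = (\<lambda>v. Q (cut Y v))"

end

theory Submission
  imports Defs
begin

text \<open>
Write \<open>h\<^sub>t\<close> for the extension of \<open>T\<^sub>t\<close> to \<open>L\<^sup>\<infinity>\<close>, applied to the constant \<open>1\<close>.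

Everything about \<open>h\<^sub>t\<close> comes from one duality: \<open>\<integral> T\<^sub>t f = \<integral> f h\<^sub>t\<close> for nonnegative \<open>f\<close> in \<open>L\<^sup>1 \<inter> L\<^sup>2\<close>
(\<open>integral_T\<close>). It determines \<open>h\<^sub>t\<close> without reference to the exhausting sequence, and with the semigroup
law it shows that \<open>h\<^sub>t\<close> decreases in \<open>t\<close>; hence \<open>h\<^sub>t = 1\<close> on \<open>X_cons\<close> for all real times, not only for
the integer times that define this set (\<open>one_on_X_cons\<close>).

The set \<open>X_cons\<close> is invariant because mass is preserved there. If \<open>f \<ge> 0\<close> lives on \<open>X_cons\<close>, then
\<open>\<integral> T\<^sub>t f h\<^sub>k = \<integral> f h\<^bsub>k+t\<^esub> = \<integral> f = \<integral> T\<^sub>t f\<close>, so \<open>T\<^sub>t f\<close> vanishes wherever some \<open>h\<^sub>k < 1\<close>, which is on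
\<open>X_diss\<close> (\<open>T_vanishes_off_X_cons\<close>). Symmetry of \<open>T\<^sub>t\<close> gives the converse direction, and so \<open>T\<^sub>t\<close>
commutes with multiplication by the indicator of \<open>X_cons\<close> (\<open>X_cons_invariant\<close>).

An operator that commutes with the semigroup commutes with its generator \<open>-A\<close>. For \<open>u\<close> in the domain
of \<open>A\<close> and \<open>Y\<close> invariant, the functions \<open>1\<^sub>Y u\<close> and \<open>u - 1\<^sub>Y u\<close> are therefore in the domain of \<open>A\<close> and
\<open>\<E>\<close>-orthogonal, since \<open>(1\<^sub>Y A u, u - 1\<^sub>Y u) = 0\<close>. The domain of \<open>A\<close> is a core of the form
(\<open>generator_domain_dense\<close>); this follows from a version of the Riesz representation theorem for
subspaces of the form domain (\<open>Riesz_on_subspace\<close>), once to solve \<open>(A + 1) u = f\<close> and once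
to project onto the closure of the domain of \<open>A\<close>. Closedness then carries the splitting
\<open>\<E>[u] = \<E>[1\<^sub>Y u] + \<E>[u - 1\<^sub>Y u]\<close> over to the whole form domain (\<open>form_split\<close>).

Thus the parts of \<open>\<E>\<close> on \<open>X_cons\<close> and \<open>X_diss\<close> have the required sum. They inherit the Dirichlet
property from \<open>\<E>\<close>, and the semigroup of a part is \<open>u \<mapsto> T\<^sub>t (1\<^sub>Y u)\<close> (\<open>part_associated\<close>), whose extension
to \<open>1\<^sub>Y\<close> is the restriction of \<open>h\<^sub>t\<close> by duality (\<open>one_restricted\<close>); so conservativeness and
dissipativeness are read off from \<open>h\<^sub>t\<close>. Uniqueness is algebra: two forms living on complementary
sets whose sum is \<open>\<E>\<close> are recovered by evaluating \<open>\<E>\<close> at \<open>1\<^sub>Y u\<close>, where the other one vanishes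
(\<open>part_unique\<close>).
\<close>

section \<open>Square integrable functions\<close>

text \<open>The discriminant criterion for a nonnegative quadratic polynomial. It yields the Cauchy-Schwarz
inequality, and for \<open>a = 0\<close> the vanishing of the first variation at a minimum.\<close>

lemma discriminant_bound:
  fixes a b c :: real
  assumes "\<And>s. 0 \<le> a + 2 * s * b + s\<^sup>2 * c" and "0 \<le> c"
  shows "b\<^sup>2 \<le> a * c"
proof (cases "c = 0")
  case True
  have "b = 0"
  proof (rule ccontr)
    assume "b \<noteq> 0"
    with assms(1)[of "- (a + 1) / (2 * b)"] True show False by (simp add: field_simps)
  qed
  then show ?thesis using True by simp
next
  case False
  with \<open>0 \<le> c\<close> have "0 < c" by simp
  have "0 \<le> a + 2 * (- b / c) * b + (- b / c)\<^sup>2 * c" by (rule assms)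
  also have "\<dots> = a - b\<^sup>2 / c"
    using \<open>0 < c\<close> by (simp add: field_simps power2_eq_square)
  finally show ?thesis using \<open>0 < c\<close> by (simp add: field_simps)
qed

lemma L2_measurable: "u \<in> L2 M \<Longrightarrow> u \<in> borel_measurable M"
  by (simp add: L2_def)

lemma L2_mult_integrable:
  assumes "u \<in> L2 M" "v \<in> L2 M"
  shows "integrable M (\<lambda>x. u x * v x)"
proof (rule Bochner_Integration.integrable_bound)
  show "integrable M (\<lambda>x. (u x)\<^sup>2 + (v x)\<^sup>2)" using assms by (simp add: L2_def)
  show "(\<lambda>x. u x * v x) \<in> borel_measurable M" using assms by (auto simp: L2_def)
  have "\<bar>a * b\<bar> \<le> a\<^sup>2 + b\<^sup>2" for a b :: real
  proof -
    have "2 * \<bar>a\<bar> * \<bar>b\<bar> \<le> \<bar>a\<bar>\<^sup>2 + \<bar>b\<bar>\<^sup>2" by (rule sum_squares_bound)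
    moreover have "0 \<le> \<bar>a\<bar> * \<bar>b\<bar>" by simp
    ultimately show ?thesis unfolding abs_mult power2_abs by linarith
  qed
  then show "AE x in M. norm (u x * v x) \<le> norm ((u x)\<^sup>2 + (v x)\<^sup>2)" by simp
qed

lemma L2_bound:
  assumes "u \<in> L2 M" "v \<in> borel_measurable M" "AE x in M. \<bar>v x\<bar> \<le> \<bar>u x\<bar>"
  shows "v \<in> L2 M"
proof -
  have "integrable M (\<lambda>x. (v x)\<^sup>2)"
  proof (rule Bochner_Integration.integrable_bound)
    show "integrable M (\<lambda>x. (u x)\<^sup>2)" using assms by (simp add: L2_def)
    show "(\<lambda>x. (v x)\<^sup>2) \<in> borel_measurable M" using assms by simp
    show "AE x in M. norm ((v x)\<^sup>2) \<le> norm ((u x)\<^sup>2)"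
      using assms(3) by eventually_elim (simp add: abs_le_square_iff)
  qed
  then show ?thesis using assms by (simp add: L2_def)
qed

lemma L2_cong_AE:
  assumes "u \<in> L2 M" "v \<in> borel_measurable M" "AE x in M. u x = v x"
  shows "v \<in> L2 M"
  by (rule L2_bound[OF assms(1,2)]) (use assms(3) in eventually_elim, simp)

lemma L2_zero [simp]: "(\<lambda>x. 0) \<in> L2 M"
  by (simp add: L2_def)

lemma L2_scale [simp]: "u \<in> L2 M \<Longrightarrow> (\<lambda>x. c * u x) \<in> L2 M"
  by (auto simp: L2_def power_mult_distrib)

lemma L2_add [simp]:
  assumes "u \<in> L2 M" "v \<in> L2 M"
  shows "(\<lambda>x. u x + v x) \<in> L2 M"
  using assms L2_mult_integrable[OF assms]
  by (auto simp: L2_def power2_sum mult.assoc)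

lemma L2_diff [simp]:
  assumes "u \<in> L2 M" "v \<in> L2 M"
  shows "(\<lambda>x. u x - v x) \<in> L2 M"
  using L2_add[OF assms(1) L2_scale[OF assms(2), of "-1"]] by simp

lemma L2_inner_commute: "L2_inner M u v = L2_inner M v u"
  by (simp add: L2_inner_def mult.commute)

lemma L2_inner_add_left:
  assumes "u \<in> L2 M" "v \<in> L2 M" "w \<in> L2 M"
  shows "L2_inner M (\<lambda>x. u x + v x) w = L2_inner M u w + L2_inner M v w"
  using assms by (simp add: L2_inner_def distrib_right L2_mult_integrable)

lemma L2_inner_diff_left:
  assumes "u \<in> L2 M" "v \<in> L2 M" "w \<in> L2 M"
  shows "L2_inner M (\<lambda>x. u x - v x) w = L2_inner M u w - L2_inner M v w"
  using assms by (simp add: L2_inner_def left_diff_distrib L2_mult_integrable)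

lemma L2_inner_scale_left: "L2_inner M (\<lambda>x. c * u x) w = c * L2_inner M u w"
  by (simp add: L2_inner_def mult.assoc)

lemma L2_inner_add_right:
  assumes "u \<in> L2 M" "v \<in> L2 M" "w \<in> L2 M"
  shows "L2_inner M w (\<lambda>x. u x + v x) = L2_inner M w u + L2_inner M w v"
  using L2_inner_add_left[OF assms] by (simp add: L2_inner_commute)

lemma L2_inner_scale_right: "L2_inner M w (\<lambda>x. c * u x) = c * L2_inner M w u"
  using L2_inner_scale_left[of M c u w] by (simp add: L2_inner_commute)

lemma L2_inner_self_nonneg: "0 \<le> L2_inner M u u"
  by (simp add: L2_inner_def)

lemma L2_norm_nonneg: "0 \<le> L2_norm M u"
  by (simp add: L2_norm_def L2_inner_self_nonneg)

lemma L2_norm_square: "(L2_norm M u)\<^sup>2 = L2_inner M u u"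
  by (simp add: L2_norm_def L2_inner_self_nonneg)

lemma L2_inner_cong_AE:
  assumes "u \<in> borel_measurable M" "u' \<in> borel_measurable M"
    "v \<in> borel_measurable M" "v' \<in> borel_measurable M"
    "AE x in M. u x = u' x" "AE x in M. v x = v' x"
  shows "L2_inner M u v = L2_inner M u' v'"
  unfolding L2_inner_def
  by (rule integral_cong_AE) (use assms in auto)

lemma L2_norm_cong_AE:
  assumes "u \<in> borel_measurable M" "v \<in> borel_measurable M" "AE x in M. u x = v x"
  shows "L2_norm M u = L2_norm M v"
  using L2_inner_cong_AE[OF assms(1,2) assms(1,2) assms(3,3)] by (simp add: L2_norm_def)

lemma L2_norm_mono:
  assumes "u \<in> borel_measurable M" "v \<in> L2 M" "AE x in M. \<bar>u x\<bar> \<le> \<bar>v x\<bar>"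
  shows "L2_norm M u \<le> L2_norm M v"
proof -
  have u: "u \<in> L2 M" using assms L2_bound by blast
  have "L2_inner M u u \<le> L2_inner M v v" unfolding L2_inner_def
  proof (rule integral_mono_AE)
    show "AE x in M. u x * u x \<le> v x * v x"
      using assms(3) by eventually_elim (simp add: abs_le_square_iff power2_eq_square)
  qed (use u assms L2_mult_integrable in auto)
  then show ?thesis by (simp add: L2_norm_def)
qed

lemma L2_norm_zero_imp_AE:
  assumes "u \<in> L2 M" "L2_norm M u = 0"
  shows "AE x in M. u x = 0"
proof -
  have "(\<integral>x. u x * u x \<partial>M) = 0"
    using assms(2) L2_norm_square[of M u] by (simp add: L2_inner_def)
  then have "AE x in M. u x * u x = 0"
    using integral_nonneg_eq_0_iff_AE[of M "\<lambda>x. u x * u x"] L2_mult_integrable[OF assms(1,1)]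
    by simp
  then show ?thesis by simp
qed

lemma L2_Cauchy_Schwarz:
  assumes "u \<in> L2 M" "v \<in> L2 M"
  shows "\<bar>L2_inner M u v\<bar> \<le> L2_norm M u * L2_norm M v"
proof -
  have "0 \<le> L2_inner M u u + 2 * s * L2_inner M u v + s\<^sup>2 * L2_inner M v v" for s
  proof -
    have "0 \<le> L2_inner M (\<lambda>x. u x + s * v x) (\<lambda>x. u x + s * v x)"
      by (rule L2_inner_self_nonneg)
    also have "\<dots> = L2_inner M u u + 2 * s * L2_inner M u v + s\<^sup>2 * L2_inner M v v"
      using assms L2_inner_commute[of M v u]
      by (simp add: L2_inner_add_left L2_inner_scale_left L2_inner_add_right L2_inner_scale_right
          power2_eq_square algebra_simps)
    finally show ?thesis .
  qed
  from discriminant_bound[OF this] have "(L2_inner M u v)\<^sup>2 \<le> (L2_norm M u * L2_norm M v)\<^sup>2"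
    by (simp add: L2_inner_self_nonneg power_mult_distrib L2_norm_square)
  then show ?thesis
    by (simp add: abs_le_square_iff[symmetric] L2_norm_nonneg)
qed

lemma L2_norm_triangle:
  assumes "u \<in> L2 M" "v \<in> L2 M"
  shows "L2_norm M (\<lambda>x. u x - v x) \<le> L2_norm M u + L2_norm M v"
proof -
  have "(L2_norm M (\<lambda>x. u x - v x))\<^sup>2 =
      (L2_norm M u)\<^sup>2 - 2 * L2_inner M u v + (L2_norm M v)\<^sup>2"
    using assms L2_inner_commute[of M v u]
      L2_inner_diff_left[OF assms L2_diff[OF assms]]
      L2_inner_commute[of M u "\<lambda>x. u x - v x"] L2_inner_commute[of M v "\<lambda>x. u x - v x"]
      L2_inner_diff_left[OF assms assms(1)] L2_inner_diff_left[OF assms assms(2)]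
    by (simp only: L2_norm_square)
  also have "\<dots> \<le> (L2_norm M u + L2_norm M v)\<^sup>2"
    using L2_Cauchy_Schwarz[OF assms] by (simp add: power2_sum)
  finally show ?thesis
    by (rule power2_le_imp_le) (simp add: L2_norm_nonneg)
qed

lemma cut_cut [simp]: "cut Y (cut Y u) = cut Y u"
  by (auto simp: cut_def indicator_def)

lemma cut_compl_cut [simp]: "cut (- Y) (cut Y u) = (\<lambda>x. 0)" "cut Y (cut (- Y) u) = (\<lambda>x. 0)"
  by (auto simp: cut_def indicator_def)

lemma cut_add: "cut Y (\<lambda>x. u x + v x) = (\<lambda>x. cut Y u x + cut Y v x)"
  by (simp add: cut_def distrib_left)

lemma cut_diff: "cut Y (\<lambda>x. u x - v x) = (\<lambda>x. cut Y u x - cut Y v x)"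
  by (simp add: cut_def right_diff_distrib)

lemma cut_scale: "cut Y (\<lambda>x. c * u x) = (\<lambda>x. c * cut Y u x)"
  by (simp add: cut_def mult.left_commute)

lemma cut_zero [simp]: "cut Y (\<lambda>x. 0) = (\<lambda>x. 0)"
  by (simp add: cut_def)

lemma cut_plus_cut_compl: "(\<lambda>x. cut Y u x + cut (- Y) u x) = u"
  by (auto simp: cut_def indicator_def)

lemma abs_cut_le: "\<bar>cut Y u x\<bar> \<le> \<bar>u x\<bar>"
  by (simp add: cut_def indicator_def)

lemma cut_measurable:
  "Y \<in> sets M \<Longrightarrow> u \<in> borel_measurable M \<Longrightarrow> cut Y u \<in> borel_measurable M"
  unfolding cut_def by (intro borel_measurable_times borel_measurable_indicator)

lemma L2_cut: "Y \<in> sets M \<Longrightarrow> u \<in> L2 M \<Longrightarrow> cut Y u \<in> L2 M"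
  by (rule L2_bound) (auto simp: abs_cut_le intro: cut_measurable L2_measurable)

lemma L2_norm_cut_le: "Y \<in> sets M \<Longrightarrow> u \<in> L2 M \<Longrightarrow> L2_norm M (cut Y u) \<le> L2_norm M u"
  by (rule L2_norm_mono) (auto simp: abs_cut_le intro: cut_measurable L2_measurable)

lemma L2_inner_cut_left: "L2_inner M (cut Y u) v = L2_inner M u (cut Y v)"
  by (simp add: L2_inner_def cut_def mult.commute mult.left_commute)

section \<open>Closed forms as Hilbert spaces\<close>

definition form_inner :: "'a measure \<Rightarrow> 'a form \<Rightarrow> ('a \<Rightarrow> real) \<Rightarrow> ('a \<Rightarrow> real) \<Rightarrow> real" where
  "form_inner M E u v = polar E u v + L2_inner M u v"

locale closed_quadratic_form =
  fixes M :: "'a measure" and E :: "'a form"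
  assumes quadratic: "quadratic_form M E"
    and closed: "closed_form M E"
begin

lemma dom_L2: "u \<in> dom E \<Longrightarrow> u \<in> L2 M"
  using quadratic by (auto simp: quadratic_form_def)

lemma form_cong_AE:
  "u \<in> dom E \<Longrightarrow> v \<in> borel_measurable M \<Longrightarrow> AE x in M. u x = v x \<Longrightarrow> E v = E u"
  using quadratic unfolding quadratic_form_def by blast

lemma dom_cong_AE:
  "u \<in> dom E \<Longrightarrow> v \<in> borel_measurable M \<Longrightarrow> AE x in M. u x = v x \<Longrightarrow> v \<in> dom E"
  using form_cong_AE by (simp add: domIff)

lemma dom_zero [simp]: "(\<lambda>x. 0) \<in> dom E"
  using quadratic unfolding quadratic_form_def by blast

lemma dom_add [simp]: "u \<in> dom E \<Longrightarrow> v \<in> dom E \<Longrightarrow> (\<lambda>x. u x + v x) \<in> dom E"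
  using quadratic unfolding quadratic_form_def by blast

lemma dom_scale [simp]: "u \<in> dom E \<Longrightarrow> (\<lambda>x. c * u x) \<in> dom E"
  using quadratic unfolding quadratic_form_def by blast

lemma dom_diff [simp]: "u \<in> dom E \<Longrightarrow> v \<in> dom E \<Longrightarrow> (\<lambda>x. u x - v x) \<in> dom E"
  using dom_add[of u "\<lambda>x. -1 * v x"] dom_scale[of v "-1"] by simp

lemma form_nonneg: "u \<in> dom E \<Longrightarrow> 0 \<le> the (E u)"
  using quadratic unfolding quadratic_form_def by blast

lemma polar_is_bilinear:
  obtains a where "\<And>u v. u \<in> dom E \<Longrightarrow> v \<in> dom E \<Longrightarrow> polar E u v = a u v"
    "\<And>u v. u \<in> dom E \<Longrightarrow> v \<in> dom E \<Longrightarrow> a u v = a v u"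
    "\<And>u v w. u \<in> dom E \<Longrightarrow> v \<in> dom E \<Longrightarrow> w \<in> dom E \<Longrightarrow> a (\<lambda>x. u x + v x) w = a u w + a v w"
    "\<And>c u v. u \<in> dom E \<Longrightarrow> v \<in> dom E \<Longrightarrow> a (\<lambda>x. c * u x) v = c * a u v"
    "\<And>u. u \<in> dom E \<Longrightarrow> the (E u) = a u u"
proof -
  obtain a where sym: "\<forall>u\<in>dom E. \<forall>v\<in>dom E. a u v = a v u"
    and add: "\<forall>u\<in>dom E. \<forall>v\<in>dom E. \<forall>w\<in>dom E. a (\<lambda>x. u x + v x) w = a u w + a v w"
    and scale: "\<forall>c. \<forall>u\<in>dom E. \<forall>v\<in>dom E. a (\<lambda>x. c * u x) v = c * a u v"
    and self: "\<forall>u\<in>dom E. the (E u) = a u u"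
    using quadratic unfolding quadratic_form_def by blast
  have diff: "a (\<lambda>x. u x - v x) w = a u w - a v w"
    if "u \<in> dom E" "v \<in> dom E" "w \<in> dom E" for u v w
    using add[rule_format, of u "\<lambda>x. -1 * v x" w] scale[rule_format, of v w "-1"]
      dom_scale[of v "-1"] that by simp
  have "polar E u v = a u v" if "u \<in> dom E" "v \<in> dom E" for u v
  proof -
    have "a (\<lambda>x. u x + v x) (\<lambda>x. u x + v x) = a u u + 2 * a u v + a v v"
      "a (\<lambda>x. u x - v x) (\<lambda>x. u x - v x) = a u u - 2 * a u v + a v v"
      using that add diff sym[rule_format, of u "\<lambda>x. u x + v x"] sym[rule_format, of v "\<lambda>x. u x + v x"]
        sym[rule_format, of u "\<lambda>x. u x - v x"] sym[rule_format, of v "\<lambda>x. u x - v x"]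
        sym[rule_format, of v u]
      by auto
    then show ?thesis using that self by (simp add: polar_def)
  qed
  then show ?thesis using that sym add scale self by blast
qed

lemma polar_commute: "u \<in> dom E \<Longrightarrow> v \<in> dom E \<Longrightarrow> polar E u v = polar E v u"
  by (rule polar_is_bilinear) simp

lemma polar_self: "u \<in> dom E \<Longrightarrow> polar E u u = the (E u)"
  by (rule polar_is_bilinear) simp

lemma polar_add_left: "u \<in> dom E \<Longrightarrow> v \<in> dom E \<Longrightarrow> w \<in> dom E \<Longrightarrow>
    polar E (\<lambda>x. u x + v x) w = polar E u w + polar E v w"
  by (rule polar_is_bilinear) simp

lemma polar_scale_left: "u \<in> dom E \<Longrightarrow> v \<in> dom E \<Longrightarrow> polar E (\<lambda>x. c * u x) v = c * polar E u v"
  by (rule polar_is_bilinear) simp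

lemma form_inner_commute: "u \<in> dom E \<Longrightarrow> v \<in> dom E \<Longrightarrow> form_inner M E u v = form_inner M E v u"
  by (simp add: form_inner_def polar_commute L2_inner_commute)

lemma form_inner_add_left: "u \<in> dom E \<Longrightarrow> v \<in> dom E \<Longrightarrow> w \<in> dom E \<Longrightarrow>
    form_inner M E (\<lambda>x. u x + v x) w = form_inner M E u w + form_inner M E v w"
  by (simp add: form_inner_def polar_add_left L2_inner_add_left dom_L2)

lemma form_inner_scale_left: "u \<in> dom E \<Longrightarrow> v \<in> dom E \<Longrightarrow>
    form_inner M E (\<lambda>x. c * u x) v = c * form_inner M E u v"
  by (simp add: form_inner_def polar_scale_left L2_inner_scale_left distrib_left)

lemma form_inner_diff_left: "u \<in> dom E \<Longrightarrow> v \<in> dom E \<Longrightarrow> w \<in> dom E \<Longrightarrow>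
    form_inner M E (\<lambda>x. u x - v x) w = form_inner M E u w - form_inner M E v w"
  using form_inner_add_left[of u "\<lambda>x. -1 * v x" w] form_inner_scale_left[of v w "-1"]
    dom_scale[of v "-1"] by simp

lemma form_inner_add_right: "u \<in> dom E \<Longrightarrow> v \<in> dom E \<Longrightarrow> w \<in> dom E \<Longrightarrow>
    form_inner M E w (\<lambda>x. u x + v x) = form_inner M E w u + form_inner M E w v"
  by (simp add: form_inner_commute[of w] form_inner_add_left)

lemma form_inner_scale_right: "u \<in> dom E \<Longrightarrow> v \<in> dom E \<Longrightarrow>
    form_inner M E v (\<lambda>x. c * u x) = c * form_inner M E v u"
  by (simp add: form_inner_commute[of v] form_inner_scale_left)

lemma form_inner_diff_right: "u \<in> dom E \<Longrightarrow> v \<in> dom E \<Longrightarrow> w \<in> dom E \<Longrightarrow>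
    form_inner M E w (\<lambda>x. u x - v x) = form_inner M E w u - form_inner M E w v"
  by (simp add: form_inner_commute[of w] form_inner_diff_left)

lemmas form_inner_linear =
  form_inner_add_left form_inner_scale_left form_inner_diff_left
  form_inner_add_right form_inner_scale_right form_inner_diff_right

lemma form_inner_self_nonneg: "u \<in> dom E \<Longrightarrow> 0 \<le> form_inner M E u u"
  by (simp add: form_inner_def polar_self form_nonneg L2_inner_self_nonneg)

lemma form_norm_square: "u \<in> dom E \<Longrightarrow> (form_norm M E u)\<^sup>2 = form_inner M E u u"
  by (simp add: form_norm_def form_inner_def polar_self form_nonneg L2_norm_square
      L2_inner_self_nonneg)

lemma form_norm_nonneg: "u \<in> dom E \<Longrightarrow> 0 \<le> form_norm M E u"
  by (simp add: form_norm_def form_nonneg)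

lemma L2_norm_le_form_norm: "u \<in> dom E \<Longrightarrow> L2_norm M u \<le> form_norm M E u"
  unfolding form_norm_def by (rule real_le_rsqrt) (simp add: form_nonneg)

lemma form_norm_cong_AE:
  assumes "u \<in> dom E" "v \<in> borel_measurable M" "AE x in M. u x = v x"
  shows "form_norm M E v = form_norm M E u"
  using form_cong_AE[OF assms] L2_norm_cong_AE[of u M v] assms dom_L2[OF assms(1)]
  by (simp add: form_norm_def L2_measurable)

lemma form_Cauchy_Schwarz:
  assumes "u \<in> dom E" "v \<in> dom E"
  shows "\<bar>form_inner M E u v\<bar> \<le> form_norm M E u * form_norm M E v"
proof -
  have "0 \<le> form_inner M E u u + 2 * s * form_inner M E u v + s\<^sup>2 * form_inner M E v v" for s
  proof -
    have "0 \<le> form_inner M E (\<lambda>x. u x + s * v x) (\<lambda>x. u x + s * v x)"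
      using assms by (simp add: form_inner_self_nonneg)
    also have "\<dots> = form_inner M E u u + 2 * s * form_inner M E u v + s\<^sup>2 * form_inner M E v v"
      using assms form_inner_commute[of v u]
      by (simp add: form_inner_linear power2_eq_square algebra_simps)
    finally show ?thesis .
  qed
  from discriminant_bound[OF this]
  have "(form_inner M E u v)\<^sup>2 \<le> (form_norm M E u * form_norm M E v)\<^sup>2"
    using assms by (simp add: form_inner_self_nonneg power_mult_distrib form_norm_square)
  then show ?thesis
    using assms by (simp add: abs_le_square_iff[symmetric] form_norm_nonneg)
qed

lemma form_norm_triangle:
  assumes "u \<in> dom E" "v \<in> dom E"
  shows "form_norm M E (\<lambda>x. u x - v x) \<le> form_norm M E u + form_norm M E v"
proof -
  have "(form_norm M E (\<lambda>x. u x - v x))\<^sup>2 =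
      (form_norm M E u)\<^sup>2 - 2 * form_inner M E u v + (form_norm M E v)\<^sup>2"
    using assms form_inner_commute[of v u] by (simp add: form_norm_square form_inner_linear)
  also have "\<dots> \<le> (form_norm M E u + form_norm M E v)\<^sup>2"
    using form_Cauchy_Schwarz[OF assms] by (simp add: power2_sum)
  finally show ?thesis
    by (rule power2_le_imp_le) (use assms in \<open>simp add: form_norm_nonneg\<close>)
qed

lemma form_inner_tendsto:
  assumes v: "\<And>n. v n \<in> dom E" and p: "p \<in> dom E" and w: "w \<in> dom E"
    and lim: "(\<lambda>n. form_norm M E (\<lambda>x. v n x - p x)) \<longlonglongrightarrow> 0"
  shows "(\<lambda>n. form_inner M E (v n) w) \<longlonglongrightarrow> form_inner M E p w"
proof -
  have "(\<lambda>n. form_inner M E (v n) w - form_inner M E p w) \<longlonglongrightarrow> 0"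
  proof (rule Lim_null_comparison)
    show "\<forall>\<^sub>F n in sequentially. norm (form_inner M E (v n) w - form_inner M E p w)
        \<le> form_norm M E (\<lambda>x. v n x - p x) * form_norm M E w"
      using form_Cauchy_Schwarz[OF dom_diff[OF v p] w] v p w
      by (simp add: form_inner_diff_left)
    show "(\<lambda>n. form_norm M E (\<lambda>x. v n x - p x) * form_norm M E w) \<longlonglongrightarrow> 0"
      using tendsto_mult_left_zero[OF lim] by simp
  qed
  then show ?thesis by (simp add: LIM_zero_iff)
qed

text \<open>The limit is in the domain by assumption, so this uses no completeness; it allows closedness to be
applied to images of convergent sequences under a contraction.\<close>

lemma convergent_imp_Cauchy:
  assumes v: "\<And>n. v n \<in> dom E" and p: "p \<in> dom E"
    and lim: "(\<lambda>n. form_norm M E (\<lambda>x. v n x - p x)) \<longlonglongrightarrow> 0"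
    and e: "0 < e"
  shows "\<exists>N. \<forall>m\<ge>N. \<forall>n\<ge>N. form_norm M E (\<lambda>x. v m x - v n x) < e"
proof -
  obtain N where N: "\<And>n. n \<ge> N \<Longrightarrow> form_norm M E (\<lambda>x. v n x - p x) < e / 2"
    using LIMSEQ_D[OF lim, of "e / 2"] e by fastforce
  have "form_norm M E (\<lambda>x. v m x - v n x) < e" if "m \<ge> N" "n \<ge> N" for m n
    using form_norm_triangle[OF dom_diff[OF v p] dom_diff[OF v p], of m n] N[OF that(1)] N[OF that(2)]
    by simp
  then show ?thesis by blast
qed

text \<open>The quadratic functional \<open>J u = \<parallel>u\<parallel>\<^sup>2 - 2 l u\<close> (in the form norm) is bounded below on \<open>S\<close>, and a minimizing
sequence is a Cauchy sequence by the parallelogram law. Its limit \<open>p\<close> represents \<open>l\<close> because the first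
variation of \<open>J\<close> vanishes there. Since \<open>S\<close> need not be closed, \<open>p\<close> lies only in the closure of \<open>S\<close>,
which is why the minimizing sequence is part of the conclusion: with \<open>S\<close> the form domain the lemma is the
representation theorem, with \<open>l = (u, \<cdot>)\<close> it is the projection of \<open>u\<close> onto the closure of \<open>S\<close>.\<close>

lemma Riesz_on_subspace:
  assumes S: "S \<subseteq> dom E" "(\<lambda>x. 0) \<in> S"
      "\<And>u v. u \<in> S \<Longrightarrow> v \<in> S \<Longrightarrow> (\<lambda>x. u x + v x) \<in> S"
      "\<And>c u. u \<in> S \<Longrightarrow> (\<lambda>x. c * u x) \<in> S"
    and l: "\<And>u v. u \<in> S \<Longrightarrow> v \<in> S \<Longrightarrow> l (\<lambda>x. u x + v x) = l u + l v"
      "\<And>c u. u \<in> S \<Longrightarrow> l (\<lambda>x. c * u x) = c * l u"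
      "\<And>u. u \<in> S \<Longrightarrow> \<bar>l u\<bar> \<le> C * form_norm M E u"
  obtains v p where "\<And>n. v n \<in> S" "p \<in> dom E"
    "(\<lambda>n. form_norm M E (\<lambda>x. v n x - p x)) \<longlonglongrightarrow> 0"
    "\<And>w. w \<in> S \<Longrightarrow> form_inner M E p w = l w"
proof -
  define J where "J = (\<lambda>u. form_inner M E u u - 2 * l u)"
  have D: "u \<in> dom E" if "u \<in> S" for u using S(1) that by blast
  have "- C\<^sup>2 \<le> J u" if "u \<in> S" for u
  proof -
    have "0 \<le> (form_norm M E u - C)\<^sup>2" by simp
    then show ?thesis
      using l(3)[OF that] form_norm_square[OF D[OF that]]
      by (simp add: J_def power2_diff mult.commute mult.left_commute)
  qed
  then have bdd: "bdd_below (J ` S)" by (intro bdd_belowI[of _ "- C\<^sup>2"]) auto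
  define m where "m = Inf (J ` S)"
  have m: "m \<le> J u" if "u \<in> S" for u
    unfolding m_def by (rule cInf_lower[OF _ bdd]) (use that in auto)
  have "\<exists>u\<in>S. J u < m + inverse (real (Suc n))" for n
  proof -
    have "J ` S \<noteq> {}" using S(2) by auto
    moreover have "Inf (J ` S) < m + inverse (real (Suc n))" by (simp add: m_def)
    ultimately have "\<exists>y\<in>J ` S. y < m + inverse (real (Suc n))" by (rule cInf_lessD)
    then show ?thesis by blast
  qed
  then obtain v where v: "\<And>n. v n \<in> S" "\<And>n. J (v n) < m + inverse (real (Suc n))"
    by metis
  have J_expand: "J (\<lambda>x. u x + s * w x) =
      J u + 2 * s * (form_inner M E u w - l w) + s\<^sup>2 * form_inner M E w w"
    if "u \<in> S" "w \<in> S" for u w s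
    using D[OF that(1)] D[OF that(2)] S(4)[OF that(2)] l(1)[OF that(1), of "\<lambda>x. s * w x"] l(2)[OF that(2)]
      form_inner_commute[of w u]
    by (simp add: J_def form_inner_linear power2_eq_square algebra_simps)
  have parallelogram: "(form_norm M E (\<lambda>x. u x - w x))\<^sup>2 \<le> 2 * (J u - m) + 2 * (J w - m)"
    if "u \<in> S" "w \<in> S" for u w
  proof -
    have dS: "(\<lambda>x. w x - u x) \<in> S"
      using S(3)[OF that(2) S(4)[OF that(1), of "-1"]] by simp
    have lu: "l (\<lambda>x. w x - u x) = l w - l u"
      using l(1)[OF that(2) S(4)[OF that(1), of "-1"]] l(2)[OF that(1), of "-1"] by simp
    \<comment> \<open>The midpoint of \<open>u\<close> and \<open>w\<close>, written as a variation of \<open>u\<close> so that the expansion of \<open>J\<close> applies.\<close>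
    have mid: "(\<lambda>x. u x + (1/2) * (w x - u x)) \<in> S" using that dS S(3,4) by blast
    have norm: "(form_norm M E (\<lambda>x. u x - w x))\<^sup>2 =
        form_inner M E u u - 2 * form_inner M E u w + form_inner M E w w"
      using D[OF that(1)] D[OF that(2)] form_inner_commute[of w u]
      by (simp add: form_norm_square form_inner_linear)
    have "J (\<lambda>x. u x + (1/2) * (w x - u x)) = J u
        + (form_inner M E u (\<lambda>x. w x - u x) - (l w - l u))
        + form_inner M E (\<lambda>x. w x - u x) (\<lambda>x. w x - u x) / 4"
      unfolding J_expand[OF that(1) dS] lu by (simp add: power2_eq_square)
    also have "\<dots> = (J u + J w) / 2 - (form_norm M E (\<lambda>x. u x - w x))\<^sup>2 / 4"
      unfolding norm J_def
      using D[OF that(1)] D[OF that(2)] form_inner_commute[of w u]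
      by (simp add: form_inner_linear field_simps)
    finally have "m \<le> (J u + J w) / 2 - (form_norm M E (\<lambda>x. u x - w x))\<^sup>2 / 4"
      using m[OF mid] by simp
    then show ?thesis by (simp add: field_simps)
  qed
  have "\<exists>N. \<forall>i\<ge>N. \<forall>j\<ge>N. form_norm M E (\<lambda>x. v i x - v j x) < e" if "0 < e" for e
  proof -
    have "0 < e\<^sup>2 / 4" using that by simp
    then obtain N where N: "inverse (real (Suc N)) < e\<^sup>2 / 4"
      using reals_Archimedean by blast
    have arith: "r < d" if "r \<le> 2 * (a - m) + 2 * (b - m)" "a < m + s" "b < m + t"
        "s \<le> q" "t \<le> q" "q < d / 4" for a b d q r s t :: real
      using that by (simp add: field_simps)
    have "form_norm M E (\<lambda>x. v i x - v j x) < e" if "i \<ge> N" "j \<ge> N" for i j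
    proof -
      have "inverse (real (Suc i)) \<le> inverse (real (Suc N))"
        "inverse (real (Suc j)) \<le> inverse (real (Suc N))"
        using that by (simp_all add: le_imp_inverse_le)
      then have "(form_norm M E (\<lambda>x. v i x - v j x))\<^sup>2 < e\<^sup>2"
        by (rule arith[OF parallelogram[OF v(1) v(1)] v(2) v(2) _ _ N])
      then show ?thesis by (rule power2_less_imp_less) (use \<open>0 < e\<close> in simp)
    qed
    then show ?thesis by blast
  qed
  then obtain p where p: "p \<in> dom E" "(\<lambda>n. form_norm M E (\<lambda>x. v n x - p x)) \<longlonglongrightarrow> 0"
    using closed D v(1) unfolding closed_form_def by blast
  have "form_inner M E p w = l w" if w: "w \<in> S" for w
  proof -
    \<comment> \<open>The first variation at \<open>p\<close> is obtained in the limit from the almost minimal \<open>v n\<close>.\<close>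
    have "0 \<le> 0 + 2 * s * (form_inner M E p w - l w) + s\<^sup>2 * form_inner M E w w" for s
    proof (rule LIMSEQ_le)
      show "(\<lambda>n. - inverse (real (Suc n))) \<longlonglongrightarrow> 0"
        using tendsto_minus[OF LIMSEQ_inverse_real_of_nat] by simp
      show "(\<lambda>n. 0 + 2 * s * (form_inner M E (v n) w - l w) + s\<^sup>2 * form_inner M E w w)
          \<longlonglongrightarrow> 0 + 2 * s * (form_inner M E p w - l w) + s\<^sup>2 * form_inner M E w w"
        by (intro tendsto_intros form_inner_tendsto p) (use D v w in auto)
      have "- inverse (real (Suc n)) \<le>
          0 + 2 * s * (form_inner M E (v n) w - l w) + s\<^sup>2 * form_inner M E w w" for n
        using J_expand[OF v(1)[of n] w, of s] m[OF S(3)[OF v(1)[of n] S(4)[OF w, of s]]] v(2)[of n] by linarith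
      then show "\<exists>N. \<forall>n\<ge>N. - inverse (real (Suc n)) \<le>
          0 + 2 * s * (form_inner M E (v n) w - l w) + s\<^sup>2 * form_inner M E w w" by blast
    qed
    from discriminant_bound[OF this] show ?thesis
      using form_inner_self_nonneg[OF D[OF w]] by simp
  qed
  with that v(1) p show ?thesis by blast
qed

end

section \<open>The domain of the generator is a form core\<close>

text \<open>The domain of the operator \<open>A\<close> associated with the form, described by \<open>E(u, v) = (A u, v)\<close>.\<close>

definition generator_domain :: "'a measure \<Rightarrow> 'a form \<Rightarrow> ('a \<Rightarrow> real) set" where
  "generator_domain M E =
     {u \<in> dom E. \<exists>f\<in>L2 M. \<forall>v\<in>dom E. polar E u v = L2_inner M f v}"

context closed_quadratic_form
begin

text \<open>The function \<open>u\<close> is the resolvent \<open>(A + 1)\<^bsup>-1\<^esup> f\<close>.\<close>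

lemma resolvent_exists:
  assumes f: "f \<in> L2 M"
  obtains u where "u \<in> dom E" "\<And>v. v \<in> dom E \<Longrightarrow> form_inner M E u v = L2_inner M f v"
proof (rule Riesz_on_subspace[of "dom E" "L2_inner M f" "L2_norm M f"])
  fix u assume "u \<in> dom E"
  then show "\<bar>L2_inner M f u\<bar> \<le> L2_norm M f * form_norm M E u"
    using L2_Cauchy_Schwarz[OF f dom_L2] L2_norm_le_form_norm L2_norm_nonneg[of M f]
    by (meson mult_left_mono order_trans)
qed (use f that in \<open>auto simp: L2_inner_add_right L2_inner_scale_right dom_L2\<close>)

text \<open>Let \<open>p\<close> be the projection of \<open>u\<close> onto the closure of the domain of \<open>A\<close> in the form norm. For \<open>w\<close> in the
domain of \<open>A\<close> orthogonality reads \<open>(A w + w, p - u) = 0\<close>. The choice \<open>w = (A + 1)\<^bsup>-1\<^esup> (p - u)\<close> gives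
\<open>\<parallel>p - u\<parallel> = 0\<close>.\<close>

lemma generator_domain_dense:
  assumes u: "u \<in> dom E"
  obtains v where "\<And>n. v n \<in> generator_domain M E"
    "(\<lambda>n. form_norm M E (\<lambda>x. v n x - u x)) \<longlonglongrightarrow> 0"
proof -
  let ?S = "generator_domain M E"
  have S: "?S \<subseteq> dom E" by (auto simp: generator_domain_def)
  have zero: "(\<lambda>x. 0) \<in> ?S"
  proof -
    have "polar E (\<lambda>x. 0) v = L2_inner M (\<lambda>x. 0) v" if "v \<in> dom E" for v
      using polar_scale_left[OF that that, of 0] by (simp add: L2_inner_def)
    then show ?thesis unfolding generator_domain_def by auto
  qed
  have add: "(\<lambda>x. v x + w x) \<in> ?S" if "v \<in> ?S" "w \<in> ?S" for v w
  proof -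
    from that obtain f g where fg: "f \<in> L2 M" "g \<in> L2 M"
      "\<And>z. z \<in> dom E \<Longrightarrow> polar E v z = L2_inner M f z"
      "\<And>z. z \<in> dom E \<Longrightarrow> polar E w z = L2_inner M g z"
      by (auto simp: generator_domain_def)
    then have "\<forall>z\<in>dom E. polar E (\<lambda>x. v x + w x) z = L2_inner M (\<lambda>x. f x + g x) z"
      using S that by (auto simp: polar_add_left L2_inner_add_left dom_L2 subset_iff)
    then show ?thesis using fg S that unfolding generator_domain_def
      by (auto intro!: bexI[of _ "\<lambda>x. f x + g x"])
  qed
  have scale: "(\<lambda>x. c * v x) \<in> ?S" if "v \<in> ?S" for v c
  proof -
    from that obtain f where f: "f \<in> L2 M"
      "\<And>z. z \<in> dom E \<Longrightarrow> polar E v z = L2_inner M f z"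
      by (auto simp: generator_domain_def)
    then have "\<forall>z\<in>dom E. polar E (\<lambda>x. c * v x) z = L2_inner M (\<lambda>x. c * f x) z"
      using S that by (auto simp: polar_scale_left L2_inner_scale_left subset_iff)
    then show ?thesis using f S that unfolding generator_domain_def
      by (auto intro!: bexI[of _ "\<lambda>x. c * f x"])
  qed
  have bound: "\<bar>form_inner M E u w\<bar> \<le> form_norm M E u * form_norm M E w" if "w \<in> ?S" for w
    by (rule form_Cauchy_Schwarz[OF u]) (use S that in blast)
  obtain v p where v: "\<And>n. v n \<in> ?S" and p: "p \<in> dom E"
    and lim: "(\<lambda>n. form_norm M E (\<lambda>x. v n x - p x)) \<longlonglongrightarrow> 0"
    and orth: "\<And>w. w \<in> ?S \<Longrightarrow> form_inner M E p w = form_inner M E u w"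
    by (rule Riesz_on_subspace[OF S zero add scale _ _ bound])
      (use u S in \<open>auto simp: form_inner_add_right form_inner_scale_right subset_iff\<close>)
  have d: "(\<lambda>x. p x - u x) \<in> dom E" using u p by simp
  obtain w where w: "w \<in> dom E"
    "\<And>z. z \<in> dom E \<Longrightarrow> form_inner M E w z = L2_inner M (\<lambda>x. p x - u x) z"
    using resolvent_exists[OF dom_L2[OF d]] by blast
  have "polar E w z = L2_inner M (\<lambda>x. (p x - u x) - w x) z" if "z \<in> dom E" for z
    using w(2)[OF that] dom_L2[OF that] dom_L2[OF w(1)] dom_L2[OF d]
    by (simp add: form_inner_def L2_inner_diff_left)
  then have "w \<in> ?S"
    using w(1) dom_L2[OF w(1)] dom_L2[OF d] unfolding generator_domain_def
    by (auto intro!: bexI[of _ "\<lambda>x. (p x - u x) - w x"])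
  then have "form_inner M E w (\<lambda>x. p x - u x) = 0"
    using orth[of w] w(1) p u by (simp add: form_inner_diff_right form_inner_commute[of w])
  then have "L2_norm M (\<lambda>x. p x - u x) = 0"
    using w(2)[OF d] by (simp add: L2_norm_def)
  then have eq: "AE x in M. p x - u x = 0"
    using L2_norm_zero_imp_AE[OF dom_L2[OF d]] by simp
  have same_norm: "form_norm M E (\<lambda>x. v n x - u x) = form_norm M E (\<lambda>x. v n x - p x)" for n
  proof (rule form_norm_cong_AE)
    show "(\<lambda>x. v n x - p x) \<in> dom E" by (rule dom_diff) (use v S p in auto)
    show "(\<lambda>x. v n x - u x) \<in> borel_measurable M"
      by (rule L2_measurable, rule dom_L2, rule dom_diff) (use v S u in auto)
    show "AE x in M. v n x - p x = v n x - u x" using eq by eventually_elim simp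
  qed
  show ?thesis
    by (rule that[of v]) (simp_all only: v same_norm lim)
qed

end

section \<open>Markov semigroups and invariant sets\<close>

definition invariant_set ::
    "'a measure \<Rightarrow> (real \<Rightarrow> ('a \<Rightarrow> real) \<Rightarrow> ('a \<Rightarrow> real)) \<Rightarrow> 'a set \<Rightarrow> bool" where
  "invariant_set M T Y \<longleftrightarrow> Y \<in> sets M \<and>
     (\<forall>t>0. \<forall>u\<in>L2 M. AE x in M. T t (cut Y u) x = cut Y (T t u) x)"

locale markov_L2 =
  fixes M :: "'a measure" and T :: "real \<Rightarrow> ('a \<Rightarrow> real) \<Rightarrow> ('a \<Rightarrow> real)"
  assumes markov: "markov_semigroup M T"
begin

lemma T_L2: "0 < t \<Longrightarrow> u \<in> L2 M \<Longrightarrow> T t u \<in> L2 M"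
  using markov unfolding markov_semigroup_def by simp

lemma T_cong_AE: "0 < t \<Longrightarrow> u \<in> L2 M \<Longrightarrow> v \<in> L2 M \<Longrightarrow> AE x in M. u x = v x \<Longrightarrow>
    AE x in M. T t u x = T t v x"
  using markov unfolding markov_semigroup_def by simp

lemma T_add: "0 < t \<Longrightarrow> u \<in> L2 M \<Longrightarrow> v \<in> L2 M \<Longrightarrow>
    AE x in M. T t (\<lambda>y. u y + v y) x = T t u x + T t v x"
  using markov unfolding markov_semigroup_def by simp

lemma T_scale: "0 < t \<Longrightarrow> u \<in> L2 M \<Longrightarrow> AE x in M. T t (\<lambda>y. c * u y) x = c * T t u x"
  using markov unfolding markov_semigroup_def by simp

lemma T_contraction: "0 < t \<Longrightarrow> u \<in> L2 M \<Longrightarrow> L2_norm M (T t u) \<le> L2_norm M u"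
  using markov unfolding markov_semigroup_def by simp

lemma T_symmetric: "0 < t \<Longrightarrow> u \<in> L2 M \<Longrightarrow> v \<in> L2 M \<Longrightarrow>
    L2_inner M (T t u) v = L2_inner M u (T t v)"
  using markov unfolding markov_semigroup_def by simp

lemma T_semigroup: "0 < s \<Longrightarrow> 0 < t \<Longrightarrow> u \<in> L2 M \<Longrightarrow>
    AE x in M. T (s + t) u x = T s (T t u) x"
  using markov unfolding markov_semigroup_def by simp

lemma T_continuous: "u \<in> L2 M \<Longrightarrow>
    ((\<lambda>t. L2_norm M (\<lambda>x. T t u x - u x)) \<longlongrightarrow> 0) (at_right 0)"
  using markov unfolding markov_semigroup_def by simp

lemma T_unit: "0 < t \<Longrightarrow> u \<in> L2 M \<Longrightarrow> AE x in M. 0 \<le> u x \<and> u x \<le> 1 \<Longrightarrow>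
    AE x in M. 0 \<le> T t u x \<and> T t u x \<le> 1"
  using markov unfolding markov_semigroup_def by simp

lemma T_zero: "0 < t \<Longrightarrow> AE x in M. T t (\<lambda>x. 0) x = 0"
  using T_scale[of t "\<lambda>x. 0" 0] by simp

lemma invariant_compl:
  assumes "invariant_set M T Y"
    and space: "space M = UNIV"
  shows "invariant_set M T (- Y)"
proof -
  have Y: "Y \<in> sets M" using assms by (simp add: invariant_set_def)
  have "AE x in M. T t (cut (- Y) u) x = cut (- Y) (T t u) x" if "0 < t" "u \<in> L2 M" for t u
  proof -
    have mY: "- Y \<in> sets M" using sets.compl_sets[OF Y] by (simp add: space Compl_eq_Diff_UNIV)
    have "AE x in M. T t (\<lambda>x. cut Y u x + cut (- Y) u x) x = T t (cut Y u) x + T t (cut (- Y) u) x"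
      using T_add[OF that(1) L2_cut[OF Y that(2)] L2_cut[OF mY that(2)]] .
    moreover have "AE x in M. T t (cut Y u) x = cut Y (T t u) x"
      using assms that by (simp add: invariant_set_def)
    ultimately show ?thesis
      unfolding cut_plus_cut_compl by eventually_elim (auto simp: cut_def indicator_def)
  qed
  then show ?thesis
    using sets.compl_sets[OF Y] by (simp add: invariant_set_def space Compl_eq_Diff_UNIV)
qed

end

section \<open>Splitting a form along an invariant set\<close>

locale form_with_semigroup = closed_quadratic_form M E + markov_L2 M T
  for M :: "'a measure" and E :: "'a form" and T :: "real \<Rightarrow> ('a \<Rightarrow> real) \<Rightarrow> ('a \<Rightarrow> real)" +
  assumes associated: "associated_semigroup M E T"
    and space: "space M = UNIV"
begin

lemma generator_iff:
  "u \<in> L2 M \<Longrightarrow> f \<in> L2 M \<Longrightarrow>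
     ((\<lambda>t. L2_norm M (\<lambda>x. (u x - T t u x) / t - f x)) \<longlongrightarrow> 0) (at_right 0) \<longleftrightarrow>
     u \<in> dom E \<and> (\<forall>v\<in>dom E. polar E u v = L2_inner M f v)"
  using associated unfolding associated_semigroup_def by blast

text \<open>The difference quotients of the semigroup at \<open>cut Y u\<close> are those at \<open>u\<close>, cut off to \<open>Y\<close>, and cutting off
is a contraction of \<open>L\<^sup>2\<close>.\<close>

lemma cut_generator:
  assumes inv: "invariant_set M T Y"
    and u: "u \<in> dom E" and f: "f \<in> L2 M" and A: "\<forall>v\<in>dom E. polar E u v = L2_inner M f v"
  shows "cut Y u \<in> dom E" "\<And>v. v \<in> dom E \<Longrightarrow> polar E (cut Y u) v = L2_inner M (cut Y f) v"
proof -
  have Y: "Y \<in> sets M" using inv by (simp add: invariant_set_def)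
  have uL: "u \<in> L2 M" by (rule dom_L2[OF u])
  have "((\<lambda>t. L2_norm M (\<lambda>x. (u x - T t u x) / t - f x)) \<longlongrightarrow> 0) (at_right 0)"
    using generator_iff[OF uL f] u A by blast
  moreover have "\<forall>\<^sub>F t in at_right 0. norm (L2_norm M (\<lambda>x. (cut Y u x - T t (cut Y u) x) / t - cut Y f x))
      \<le> L2_norm M (\<lambda>x. (u x - T t u x) / t - f x)"
    unfolding eventually_at_right_field
  proof (intro exI[of _ 1] conjI allI impI)
    fix t :: real assume t: "0 < t" "t < 1"
    have L: "(\<lambda>x. (u x - T t u x) / t - f x) \<in> L2 M"
      using L2_diff[OF L2_scale[OF L2_diff[OF uL T_L2[OF t(1) uL]], of "1 / t"] f] by simp
    have "L2_norm M (\<lambda>x. (cut Y u x - T t (cut Y u) x) / t - cut Y f x)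
        \<le> L2_norm M (\<lambda>x. (u x - T t u x) / t - f x)"
    proof (rule L2_norm_mono[OF _ L])
      have "T t (cut Y u) \<in> borel_measurable M"
        using L2_measurable T_L2 L2_cut t(1) Y uL by blast
      then show "(\<lambda>x. (cut Y u x - T t (cut Y u) x) / t - cut Y f x) \<in> borel_measurable M"
        using cut_measurable[OF Y L2_measurable[OF uL]] cut_measurable[OF Y L2_measurable[OF f]]
        by simp
      have "AE x in M. T t (cut Y u) x = cut Y (T t u) x"
        using inv t uL by (simp add: invariant_set_def)
      then show "AE x in M. \<bar>(cut Y u x - T t (cut Y u) x) / t - cut Y f x\<bar>
          \<le> \<bar>(u x - T t u x) / t - f x\<bar>"
        by eventually_elim (auto simp: cut_def indicator_def)
    qed
    then show "norm (L2_norm M (\<lambda>x. (cut Y u x - T t (cut Y u) x) / t - cut Y f x))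
      \<le> L2_norm M (\<lambda>x. (u x - T t u x) / t - f x)"
      by (simp add: L2_norm_nonneg)
  qed simp
  ultimately have
    "((\<lambda>t. L2_norm M (\<lambda>x. (cut Y u x - T t (cut Y u) x) / t - cut Y f x)) \<longlongrightarrow> 0) (at_right 0)"
    by (rule Lim_null_comparison[rotated])
  then have "cut Y u \<in> dom E \<and> (\<forall>v\<in>dom E. polar E (cut Y u) v = L2_inner M (cut Y f) v)"
    using generator_iff[OF L2_cut[OF Y uL] L2_cut[OF Y f]] by blast
  then show "cut Y u \<in> dom E" "\<And>v. v \<in> dom E \<Longrightarrow> polar E (cut Y u) v = L2_inner M (cut Y f) v"
    by auto
qed

text \<open>For functions in the domain of \<open>A\<close>, orthogonality in the form is orthogonality of \<open>cut Y (A u)\<close> and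
\<open>cut (- Y) w\<close> in \<open>L\<^sup>2\<close>. By the Pythagorean theorem, cutting off does not increase the form norm.\<close>

lemma cut_generator_domain:
  assumes inv: "invariant_set M T Y"
    and u: "u \<in> generator_domain M E" and w: "w \<in> generator_domain M E"
  shows "cut Y u \<in> dom E" "polar E (cut Y u) (cut (- Y) w) = 0"
    "form_norm M E (cut Y u) \<le> form_norm M E u"
proof -
  have Y: "Y \<in> sets M" using inv by (simp add: invariant_set_def)
  from u obtain f where f: "u \<in> dom E" "f \<in> L2 M" "\<forall>v\<in>dom E. polar E u v = L2_inner M f v"
    by (auto simp: generator_domain_def)
  from w obtain g where g: "w \<in> dom E" "g \<in> L2 M" "\<forall>v\<in>dom E. polar E w v = L2_inner M g v"
    by (auto simp: generator_domain_def)
  note cu = cut_generator[OF inv f] and cw = cut_generator[OF invariant_compl[OF inv space] g]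
    and cu' = cut_generator[OF invariant_compl[OF inv space] f]
  show d: "cut Y u \<in> dom E" by (rule cu)
  show "polar E (cut Y u) (cut (- Y) w) = 0"
    using cu(2)[OF cw(1)] by (simp add: L2_inner_cut_left) (simp add: L2_inner_def)
  have "polar E (cut Y u) (cut (- Y) u) = 0"
    using cu(2)[OF cu'(1)] by (simp add: L2_inner_cut_left) (simp add: L2_inner_def)
  moreover have "L2_inner M (cut Y u) (cut (- Y) u) = 0"
    by (simp add: L2_inner_cut_left) (simp add: L2_inner_def)
  ultimately have orth: "form_inner M E (cut Y u) (cut (- Y) u) = 0"
    by (simp add: form_inner_def)
  have "(form_norm M E u)\<^sup>2 = form_inner M E (\<lambda>x. cut Y u x + cut (- Y) u x) (\<lambda>x. cut Y u x + cut (- Y) u x)"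
    using f(1) by (simp add: form_norm_square cut_plus_cut_compl)
  also have "\<dots> = (form_norm M E (cut Y u))\<^sup>2 + (form_norm M E (cut (- Y) u))\<^sup>2"
    using orth d cu'(1) form_inner_commute[OF d cu'(1)]
    by (simp add: form_norm_square form_inner_linear)
  finally have "(form_norm M E (cut Y u))\<^sup>2 \<le> (form_norm M E u)\<^sup>2" by simp
  then show "form_norm M E (cut Y u) \<le> form_norm M E u"
    by (rule power2_le_imp_le) (simp add: form_norm_nonneg f)
qed

text \<open>The cut-off sequence is Cauchy because cutting off contracts the form norm on the core. It
converges in the form domain by closedness, and its \<open>L\<^sup>2\<close> limit can only be \<open>cut Y u\<close>.\<close>

lemma cut_approximation:
  assumes inv: "invariant_set M T Y" and u: "u \<in> dom E"
    and v: "\<And>n. v n \<in> generator_domain M E"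
    and lim: "(\<lambda>n. form_norm M E (\<lambda>x. v n x - u x)) \<longlonglongrightarrow> 0"
  shows "cut Y u \<in> dom E" "(\<lambda>n. form_norm M E (\<lambda>x. cut Y (v n) x - cut Y u x)) \<longlonglongrightarrow> 0"
proof -
  have Y: "Y \<in> sets M" using inv by (simp add: invariant_set_def)
  have vD: "v n \<in> dom E" for n using v[of n] by (simp add: generator_domain_def)
  have cvD: "cut Y (v n) \<in> dom E" for n using cut_generator_domain(1)[OF inv v v] .
  have contr: "form_norm M E (\<lambda>x. cut Y (v i) x - cut Y (v j) x) \<le> form_norm M E (\<lambda>x. v i x - v j x)" for i j
  proof -
    from v[of i] obtain f where f: "f \<in> L2 M" "\<And>z. z \<in> dom E \<Longrightarrow> polar E (v i) z = L2_inner M f z"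
      by (auto simp: generator_domain_def)
    from v[of j] obtain g where g: "g \<in> L2 M" "\<And>z. z \<in> dom E \<Longrightarrow> polar E (v j) z = L2_inner M g z"
      by (auto simp: generator_domain_def)
    have "polar E (\<lambda>x. v i x + -1 * v j x) z = L2_inner M (\<lambda>x. f x + -1 * g x) z" if "z \<in> dom E" for z
      unfolding polar_add_left[OF vD dom_scale[OF vD] that] L2_inner_add_left[OF f(1) L2_scale[OF g(1)] dom_L2[OF that]]
        polar_scale_left[OF vD that] L2_inner_scale_left using f g that by simp
    then have "(\<lambda>x. v i x - v j x) \<in> generator_domain M E"
      using vD f g unfolding generator_domain_def by (auto intro!: bexI[of _ "\<lambda>x. f x - g x"])
    from cut_generator_domain(3)[OF inv this this] show ?thesis by (simp add: cut_diff)
  qed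
  have "\<exists>N. \<forall>m\<ge>N. \<forall>n\<ge>N. form_norm M E (\<lambda>x. cut Y (v m) x - cut Y (v n) x) < e" if "0 < e" for e
    using convergent_imp_Cauchy[OF vD u lim that] contr by (meson order.strict_trans1)
  then obtain p where p: "p \<in> dom E"
      "(\<lambda>n. form_norm M E (\<lambda>x. cut Y (v n) x - p x)) \<longlonglongrightarrow> 0"
    using closed[unfolded closed_form_def, THEN spec, of "\<lambda>n. cut Y (v n)"] cvD by blast
  have uL: "u \<in> L2 M" and cuL: "cut Y u \<in> L2 M" and cvL: "cut Y (v n) \<in> L2 M" and pL: "p \<in> L2 M" for n
    using dom_L2[OF u] dom_L2[OF vD] dom_L2[OF p(1)] Y by (auto intro: L2_cut)
  have le: "L2_norm M (\<lambda>x. p x - cut Y u x)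
      \<le> form_norm M E (\<lambda>x. v n x - u x) + form_norm M E (\<lambda>x. cut Y (v n) x - p x)" for n
  proof -
    have "L2_norm M (\<lambda>x. p x - cut Y u x) \<le>
        L2_norm M (\<lambda>x. cut Y (v n) x - cut Y u x) + L2_norm M (\<lambda>x. cut Y (v n) x - p x)"
      using L2_norm_triangle[OF L2_diff[OF cvL cuL] L2_diff[OF cvL pL], of n n] by simp
    also have "L2_norm M (\<lambda>x. cut Y (v n) x - cut Y u x) \<le> L2_norm M (\<lambda>x. v n x - u x)"
      using L2_norm_cut_le[OF Y L2_diff[OF dom_L2[OF vD] uL], of n] by (simp add: cut_diff)
    finally show ?thesis
      using L2_norm_le_form_norm[OF dom_diff[OF vD u], of n]
        L2_norm_le_form_norm[OF dom_diff[OF cvD p(1)], of n] by linarith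
  qed
  have "L2_norm M (\<lambda>x. p x - cut Y u x) \<le> 0"
  proof (rule LIMSEQ_le_const)
    show "(\<lambda>n. form_norm M E (\<lambda>x. v n x - u x) + form_norm M E (\<lambda>x. cut Y (v n) x - p x)) \<longlonglongrightarrow> 0"
      using tendsto_add[OF lim p(2)] by simp
  qed (use le in blast)
  then have "L2_norm M (\<lambda>x. p x - cut Y u x) = 0"
    using L2_norm_nonneg by (rule antisym)
  then have eq: "AE x in M. p x = cut Y u x"
    using L2_norm_zero_imp_AE[OF L2_diff[OF pL cuL]] by simp
  show cuD: "cut Y u \<in> dom E"
    by (rule dom_cong_AE[OF p(1) L2_measurable[OF cuL] eq])
  have "form_norm M E (\<lambda>x. cut Y (v n) x - cut Y u x) = form_norm M E (\<lambda>x. cut Y (v n) x - p x)" for n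
  proof (rule form_norm_cong_AE)
    show "(\<lambda>x. cut Y (v n) x - p x) \<in> dom E" using cvD p by simp
    show "(\<lambda>x. cut Y (v n) x - cut Y u x) \<in> borel_measurable M"
      by (rule L2_measurable[OF L2_diff[OF cvL cuL]])
    show "AE x in M. cut Y (v n) x - p x = cut Y (v n) x - cut Y u x"
      using eq by eventually_elim simp
  qed
  with p(2) show "(\<lambda>n. form_norm M E (\<lambda>x. cut Y (v n) x - cut Y u x)) \<longlonglongrightarrow> 0" by simp
qed

lemma cut_in_dom:
  assumes "invariant_set M T Y" "u \<in> dom E"
  shows "cut Y u \<in> dom E"
  using generator_domain_dense[OF assms(2)] cut_approximation(1)[OF assms] by metis

text \<open>Orthogonality holds on the core; it is extended by continuity in one argument at a time.\<close>

lemma polar_cut_orthogonal: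
  assumes inv: "invariant_set M T Y" and u: "u \<in> dom E" and w: "w \<in> dom E"
  shows "polar E (cut Y u) (cut (- Y) w) = 0"
proof -
  have L2_zero: "L2_inner M (cut Y v) (cut (- Y) z) = 0" for v z
    by (simp add: L2_inner_cut_left) (simp add: L2_inner_def)
  obtain v where v: "\<And>n. v n \<in> generator_domain M E"
    and vlim: "(\<lambda>n. form_norm M E (\<lambda>x. v n x - u x)) \<longlonglongrightarrow> 0"
    using generator_domain_dense[OF u] by blast
  obtain z where z: "\<And>n. z n \<in> generator_domain M E"
    and zlim: "(\<lambda>n. form_norm M E (\<lambda>x. z n x - w x)) \<longlonglongrightarrow> 0"
    using generator_domain_dense[OF w] by blast
  note inv' = invariant_compl[OF inv space]
  have vD: "cut Y (v n) \<in> dom E" and zD: "cut (- Y) (z n) \<in> dom E" for n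
    using cut_generator_domain(1)[OF inv v v] cut_generator_domain(1)[OF inv' z z] by auto
  have uD: "cut Y u \<in> dom E" and wD: "cut (- Y) w \<in> dom E"
    using cut_in_dom[OF inv u] cut_in_dom[OF inv' w] by auto
  have "form_inner M E (cut Y u) (cut (- Y) (z k)) = 0" for k
  proof (rule LIMSEQ_unique)
    show "(\<lambda>n. form_inner M E (cut Y (v n)) (cut (- Y) (z k))) \<longlonglongrightarrow> form_inner M E (cut Y u) (cut (- Y) (z k))"
      by (rule form_inner_tendsto[OF vD uD zD cut_approximation(2)[OF inv u v vlim]])
    show "(\<lambda>n. form_inner M E (cut Y (v n)) (cut (- Y) (z k))) \<longlonglongrightarrow> 0"
      using cut_generator_domain(2)[OF inv v z] L2_zero by (simp add: form_inner_def)
  qed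
  then have *: "form_inner M E (cut (- Y) (z k)) (cut Y u) = 0" for k
    using form_inner_commute[OF uD zD] by simp
  have "form_inner M E (cut (- Y) w) (cut Y u) = 0"
  proof (rule LIMSEQ_unique)
    show "(\<lambda>n. form_inner M E (cut (- Y) (z n)) (cut Y u)) \<longlonglongrightarrow> form_inner M E (cut (- Y) w) (cut Y u)"
      by (rule form_inner_tendsto[OF zD wD uD cut_approximation(2)[OF inv' w z zlim]])
    show "(\<lambda>n. form_inner M E (cut (- Y) (z n)) (cut Y u)) \<longlonglongrightarrow> 0" using * by simp
  qed
  then show ?thesis
    using form_inner_commute[OF uD wD] L2_zero by (simp add: form_inner_def)
qed

lemma form_split:
  assumes inv: "invariant_set M T Y" and u: "u \<in> dom E"
  shows "the (E u) = the (E (cut Y u)) + the (E (cut (- Y) u))"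
proof -
  note d = cut_in_dom[OF inv u] cut_in_dom[OF invariant_compl[OF inv space] u]
  have "the (E u) = polar E (\<lambda>x. cut Y u x + cut (- Y) u x) u"
    using u by (simp add: cut_plus_cut_compl polar_self)
  also have "\<dots> = polar E u (cut Y u) + polar E u (cut (- Y) u)"
    using d u by (simp add: polar_add_left polar_commute)
  also have "polar E u (cut Y u) = polar E (\<lambda>x. cut Y u x + cut (- Y) u x) (cut Y u)"
    by (simp add: cut_plus_cut_compl)
  also have "\<dots> = the (E (cut Y u))"
    using d polar_cut_orthogonal[OF inv u u] by (simp add: polar_add_left polar_self polar_commute)
  also have "polar E u (cut (- Y) u) = polar E (\<lambda>x. cut Y u x + cut (- Y) u x) (cut (- Y) u)"
    by (simp add: cut_plus_cut_compl)
  also have "\<dots> = the (E (cut (- Y) u))"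
    using d polar_cut_orthogonal[OF inv u u] by (simp add: polar_add_left polar_self)
  finally show ?thesis .
qed

lemma polar_cut_left:
  assumes inv: "invariant_set M T Y" and u: "u \<in> dom E" and v: "v \<in> dom E"
  shows "polar E (cut Y u) v = polar E (cut Y u) (cut Y v)"
proof -
  note d = cut_in_dom[OF inv u] cut_in_dom[OF inv v] cut_in_dom[OF invariant_compl[OF inv space] v]
  have "polar E (cut Y u) v = polar E (\<lambda>x. cut Y v x + cut (- Y) v x) (cut Y u)"
    using d(1) v by (simp add: cut_plus_cut_compl polar_commute)
  also have "\<dots> = polar E (cut Y u) (cut Y v)"
    using d polar_cut_orthogonal[OF inv u v] by (simp add: polar_add_left polar_commute)
  finally show ?thesis .
qed

end

section \<open>The extension of the semigroup to the constant one\<close>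

text \<open>With a strictly positive integrable \<open>g\<close>, the sequence \<open>min 1 ((k + 1) g)\<close> is exhausting; it reaches the
value \<open>1\<close> at every point after finitely many steps.\<close>

lemma exhausting_sequence_exists:
  assumes "sigma_finite_measure M"
  shows "\<exists>\<phi>. exhausting_sequence M \<phi>"
proof -
  interpret sigma_finite_measure M by fact
  obtain h where h: "h \<in> borel_measurable M" "integral\<^sup>N M h \<noteq> \<infinity>"
    "\<And>x. x \<in> space M \<Longrightarrow> 0 < h x \<and> h x < \<infinity>"
    using Ex_finite_integrable_function by blast
  define g where "g = (\<lambda>x. enn2real (h x))"
  have g_pos: "0 < g x" if "x \<in> space M" for x
    using h(3)[OF that] by (simp add: g_def enn2real_positive_iff)
  have g: "integrable M g"
  proof (rule integrableI_nonneg)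
    show "g \<in> borel_measurable M" using h(1) by (simp add: g_def)
    have "(\<integral>\<^sup>+x. ennreal (g x) \<partial>M) = integral\<^sup>N M h"
      by (rule nn_integral_cong) (use h(3) in \<open>auto simp: g_def\<close>)
    then show "(\<integral>\<^sup>+x. ennreal (g x) \<partial>M) < \<infinity>" using h(2) by (simp add: less_top)
  qed (simp add: g_def)
  define \<phi> where "\<phi> = (\<lambda>k x. min 1 (real (Suc k) * g x))"
  have "integrable M (\<phi> k)" for k
  proof (rule Bochner_Integration.integrable_bound)
    show "integrable M (\<lambda>x. real (Suc k) * g x)" using g by simp
    show "\<phi> k \<in> borel_measurable M" using g by (simp add: \<phi>_def)
    show "AE x in M. norm (\<phi> k x) \<le> norm (real (Suc k) * g x)"
      using g_pos by (intro AE_I2) (simp add: \<phi>_def abs_mult less_imp_le)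
  qed
  moreover have "AE x in M. (\<forall>k. 0 < \<phi> k x \<and> \<phi> k x \<le> 1) \<and> incseq (\<lambda>k. \<phi> k x) \<and> (\<lambda>k. \<phi> k x) \<longlonglongrightarrow> 1"
  proof (intro AE_I2 conjI allI)
    fix x k assume x: "x \<in> space M"
    show "0 < \<phi> k x" "\<phi> k x \<le> 1" using g_pos[OF x] by (simp_all add: \<phi>_def)
    show "incseq (\<lambda>k. \<phi> k x)"
      unfolding \<phi>_def incseq_def
      using g_pos[OF x] by (intro allI impI min.mono order_refl mult_right_mono) auto
    obtain N where N: "1 < real N * g x" using reals_Archimedean3[OF g_pos[OF x]] by blast
    have "\<phi> k x = 1" if "k \<ge> N" for k
    proof -
      have "real N * g x \<le> real (Suc k) * g x"
        using that g_pos[OF x] by (intro mult_right_mono) auto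
      then show ?thesis using N by (simp add: \<phi>_def)
    qed
    then have "\<forall>\<^sub>F k in sequentially. \<phi> k x = 1" by (auto simp: eventually_sequentially)
    then show "(\<lambda>k. \<phi> k x) \<longlonglongrightarrow> 1" by (rule tendsto_eventually)
  qed
  ultimately show ?thesis unfolding exhausting_sequence_def by blast
qed

lemma exhausting_L2:
  assumes "exhausting_sequence M \<phi>"
  shows "\<phi> k \<in> L2 M"
proof -
  have i: "integrable M (\<phi> k)" using assms by (simp add: exhausting_sequence_def)
  have "integrable M (\<lambda>x. (\<phi> k x)\<^sup>2)"
  proof (rule Bochner_Integration.integrable_bound[OF i])
    show "(\<lambda>x. (\<phi> k x)\<^sup>2) \<in> borel_measurable M" using i by auto
    have "AE x in M. 0 < \<phi> k x \<and> \<phi> k x \<le> 1"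
      using assms unfolding exhausting_sequence_def by (auto elim: AE_mp)
    then show "AE x in M. norm ((\<phi> k x)\<^sup>2) \<le> norm (\<phi> k x)"
      by eventually_elim (simp add: power2_eq_square mult_left_le)
  qed
  then show ?thesis using i by (auto simp: L2_def)
qed

lemma positive_test_function:
  assumes "sigma_finite_measure M"
  obtains w where "w \<in> L2 M" "integrable M w" "AE x in M. 0 < w x"
proof -
  obtain \<phi> where \<phi>: "exhausting_sequence M \<phi>" using exhausting_sequence_exists[OF assms] by blast
  have "AE x in M. 0 < \<phi> 0 x"
    using \<phi> unfolding exhausting_sequence_def by (auto elim: AE_mp)
  then show ?thesis using that[of "\<phi> 0"] exhausting_L2[OF \<phi>] \<phi> by (simp add: exhausting_sequence_def)
qed

lemma integrable_bounded_mult: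
  fixes f g :: "'a \<Rightarrow> real"
  assumes "integrable M f" "g \<in> borel_measurable M" "AE x in M. 0 \<le> g x \<and> g x \<le> 1"
  shows "integrable M (\<lambda>x. f x * g x)"
proof (rule Bochner_Integration.integrable_bound[OF assms(1)])
  show "(\<lambda>x. f x * g x) \<in> borel_measurable M" using assms by auto
  show "AE x in M. norm (f x * g x) \<le> norm (f x)"
    using assms(3) by eventually_elim (simp add: abs_mult mult_left_le)
qed

text \<open>Testing with a strictly positive integrable function, cut off to the set where \<open>h < g\<close>, shows that
this set is null.\<close>

lemma AE_le_by_testing:
  fixes g h :: "'a \<Rightarrow> real"
  assumes sf: "sigma_finite_measure M"
    and g: "g \<in> borel_measurable M" "AE x in M. 0 \<le> g x \<and> g x \<le> 1"
    and h: "h \<in> borel_measurable M" "AE x in M. 0 \<le> h x \<and> h x \<le> 1"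
    and le: "\<And>f. f \<in> L2 M \<Longrightarrow> integrable M f \<Longrightarrow> AE x in M. 0 \<le> f x \<Longrightarrow>
      (\<integral>x. f x * g x \<partial>M) \<le> (\<integral>x. f x * h x \<partial>M)"
  shows "AE x in M. g x \<le> h x"
proof -
  obtain w where w: "w \<in> L2 M" "integrable M w" "AE x in M. 0 < w x"
    using positive_test_function[OF sf] by blast
  define A where "A = {x \<in> space M. h x < g x}"
  have A: "A \<in> sets M" unfolding A_def using g h by measurable
  define f where "f = cut A w"
  have f: "f \<in> L2 M" "integrable M f" "AE x in M. 0 \<le> f x"
  proof -
    show "f \<in> L2 M" unfolding f_def by (rule L2_cut[OF A w(1)])
    show "integrable M f" unfolding f_def cut_def
      using integrable_mult_indicator[OF A w(2)] by simp
    show "AE x in M. 0 \<le> f x" unfolding f_def cut_def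
      using w(3) by eventually_elim simp
  qed
  have i: "integrable M (\<lambda>x. f x * g x)" "integrable M (\<lambda>x. f x * h x)"
    using f g h by (auto intro: integrable_bounded_mult)
  have nonneg: "AE x in M. 0 \<le> f x * g x - f x * h x"
    using f(3) AE_space
    by eventually_elim (auto simp: f_def cut_def A_def indicator_def right_diff_distrib[symmetric])
  have "(\<integral>x. f x * g x - f x * h x \<partial>M) \<le> 0"
    using le[OF f] i by simp
  then have "(\<integral>x. f x * g x - f x * h x \<partial>M) = 0"
    using integral_nonneg_AE[OF nonneg] by (rule antisym)
  then have "AE x in M. f x * g x - f x * h x = 0"
    using integral_nonneg_eq_0_iff_AE[OF Bochner_Integration.integrable_diff[OF i] nonneg] by simp
  then show ?thesis
    using w(3) AE_space
    by eventually_elim (auto simp: f_def cut_def A_def indicator_def not_le[symmetric] split: if_splits)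
qed

context markov_L2
begin

text \<open>The Markov property speaks of functions with values in \<open>[0, 1]\<close> only. To reach unbounded \<open>u \<ge> 0\<close>, pair
\<open>T t u\<close> with its own negative part, truncated at \<open>1\<close>: by symmetry the pairing is nonnegative, while
its integrand is nonpositive.\<close>

lemma T_nonneg:
  assumes t: "0 < t" and u: "u \<in> L2 M" and pos: "AE x in M. 0 \<le> u x"
  shows "AE x in M. 0 \<le> T t u x"
proof -
  define g where "g = (\<lambda>x. min (max (- T t u x) 0) 1)"
  have Tu: "T t u \<in> L2 M" by (rule T_L2[OF t u])
  have g: "g \<in> L2 M"
  proof (rule L2_bound[OF Tu])
    show "g \<in> borel_measurable M" unfolding g_def using L2_measurable[OF Tu] by simp
    show "AE x in M. \<bar>g x\<bar> \<le> \<bar>T t u x\<bar>" by (auto simp: g_def)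
  qed
  have "AE x in M. 0 \<le> T t g x \<and> T t g x \<le> 1"
    by (rule T_unit[OF t g]) (auto simp: g_def)
  then have "AE x in M. 0 \<le> u x * T t g x"
    using pos by eventually_elim simp
  then have "0 \<le> L2_inner M u (T t g)"
    unfolding L2_inner_def by (rule integral_nonneg_AE)
  also have "\<dots> = L2_inner M (T t u) g" by (rule T_symmetric[OF t u g, symmetric])
  finally have "(\<integral>x. - (T t u x * g x) \<partial>M) \<le> 0" by (simp add: L2_inner_def)
  moreover have nonneg: "AE x in M. 0 \<le> - (T t u x * g x)"
    by (auto simp: g_def min_def max_def mult_nonneg_nonpos mult_nonneg_nonneg mult_nonpos_nonpos)
  ultimately have "(\<integral>x. - (T t u x * g x) \<partial>M) = 0"
    using integral_nonneg_AE[OF nonneg] by simp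
  then have "AE x in M. - (T t u x * g x) = 0"
    using integral_nonneg_eq_0_iff_AE[OF _ nonneg] L2_mult_integrable[OF Tu g] by simp
  then show ?thesis by eventually_elim (auto simp: g_def min_def max_def split: if_splits)
qed

lemma T_mono:
  assumes t: "0 < t" and u: "u \<in> L2 M" and v: "v \<in> L2 M" and le: "AE x in M. u x \<le> v x"
  shows "AE x in M. T t u x \<le> T t v x"
proof -
  have "AE x in M. T t (\<lambda>x. u x + (v x - u x)) x = T t u x + T t (\<lambda>x. v x - u x) x"
    by (rule T_add) (use t u v in auto)
  moreover have "AE x in M. 0 \<le> T t (\<lambda>x. v x - u x) x"
    by (rule T_nonneg) (use t u v le in auto)
  ultimately show ?thesis by eventually_elim simp
qed

end

locale sigma_finite_markov = markov_L2 +
  assumes sigma_finite: "sigma_finite_measure M"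
begin

abbreviation one :: "real \<Rightarrow> 'a \<Rightarrow> real" where
  "one t \<equiv> Linf_extension M T t (\<lambda>_. 1)"

text \<open>The only place where the exhausting sequence chosen in the definition of the extension is
used. Positivity makes \<open>T t (\<phi> k)\<close> increasing in \<open>k\<close>, so that the limit exists almost everywhere.
The negative part of the constant function contributes \<open>T t 0 = 0\<close>.\<close>

lemma one_limit:
  assumes t: "0 < t"
  obtains \<phi> where "exhausting_sequence M \<phi>"
    "AE x in M. (\<forall>k. 0 \<le> T t (\<phi> k) x \<and> T t (\<phi> k) x \<le> 1) \<and> (\<lambda>k. T t (\<phi> k) x) \<longlonglongrightarrow> one t x"
    "one t \<in> borel_measurable M"
proof -
  define \<phi> where "\<phi> = (SOME \<phi>. exhausting_sequence M \<phi>)"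
  have \<phi>: "exhausting_sequence M \<phi>"
    unfolding \<phi>_def by (rule someI_ex[OF exhausting_sequence_exists[OF sigma_finite]])
  note L = exhausting_L2[OF \<phi>]
  have one: "one t = (\<lambda>x. lim (\<lambda>k. T t (\<phi> k) x) - lim (\<lambda>k. T t (\<lambda>x. 0) x))"
    by (simp add: Linf_extension_def Linf_extension_nonneg_def \<phi>_def[symmetric])
  have "one t \<in> borel_measurable M"
    unfolding one using L2_measurable[OF T_L2[OF t L]] L2_measurable[OF T_L2[OF t L2_zero]] by simp
  have \<phi>AE: "AE x in M. (\<forall>k. 0 < \<phi> k x \<and> \<phi> k x \<le> 1) \<and> incseq (\<lambda>k. \<phi> k x)"
    using \<phi> unfolding exhausting_sequence_def by (auto elim: AE_mp)
  have unit: "AE x in M. \<forall>k. 0 \<le> T t (\<phi> k) x \<and> T t (\<phi> k) x \<le> 1"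
    unfolding AE_all_countable
  proof
    fix k show "AE x in M. 0 \<le> T t (\<phi> k) x \<and> T t (\<phi> k) x \<le> 1"
      by (rule T_unit[OF t L]) (use \<phi>AE in eventually_elim, auto simp: less_imp_le)
  qed
  have inc: "AE x in M. \<forall>k. T t (\<phi> k) x \<le> T t (\<phi> (Suc k)) x"
    unfolding AE_all_countable
  proof
    fix k show "AE x in M. T t (\<phi> k) x \<le> T t (\<phi> (Suc k)) x"
      by (rule T_mono[OF t L L]) (use \<phi>AE in eventually_elim, auto simp: incseq_Suc_iff)
  qed
  have "AE x in M. (\<forall>k. 0 \<le> T t (\<phi> k) x \<and> T t (\<phi> k) x \<le> 1) \<and> (\<lambda>k. T t (\<phi> k) x) \<longlonglongrightarrow> one t x"
    using unit inc T_zero[OF t]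
  proof eventually_elim
    fix x assume *: "\<forall>k. 0 \<le> T t (\<phi> k) x \<and> T t (\<phi> k) x \<le> 1"
      "\<forall>k. T t (\<phi> k) x \<le> T t (\<phi> (Suc k)) x" "T t (\<lambda>x. 0) x = 0"
    have "incseq (\<lambda>k. T t (\<phi> k) x)" using *(2) by (simp add: incseq_Suc_iff)
    then obtain l where "(\<lambda>k. T t (\<phi> k) x) \<longlonglongrightarrow> l"
      using incseq_convergent[of "\<lambda>k. T t (\<phi> k) x" 1] *(1) by blast
    then have "(\<lambda>k. T t (\<phi> k) x) \<longlonglongrightarrow> lim (\<lambda>k. T t (\<phi> k) x)"
      by (simp add: limI)
    then show "(\<forall>k. 0 \<le> T t (\<phi> k) x \<and> T t (\<phi> k) x \<le> 1) \<and> (\<lambda>k. T t (\<phi> k) x) \<longlonglongrightarrow> one t x"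
      using *(1,3) by (simp add: one)
  qed
  with \<phi> \<open>one t \<in> borel_measurable M\<close> that show ?thesis by blast
qed

lemma one_measurable: "0 < t \<Longrightarrow> one t \<in> borel_measurable M"
  by (rule one_limit)

lemma one_unit:
  assumes "0 < t"
  shows "AE x in M. 0 \<le> one t x \<and> one t x \<le> 1"
proof (rule one_limit[OF assms])
  fix \<phi>
  assume "AE x in M. (\<forall>k. 0 \<le> T t (\<phi> k) x \<and> T t (\<phi> k) x \<le> 1) \<and> (\<lambda>k. T t (\<phi> k) x) \<longlonglongrightarrow> one t x"
  then show ?thesis
    by eventually_elim (meson LIMSEQ_le_const LIMSEQ_le_const2)
qed

text \<open>The duality between \<open>T t\<close> on \<open>L\<^sup>1\<close> and its extension to \<open>L\<^sup>\<infinity>\<close>, at the constant function \<open>1\<close>. Symmetry gives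
\<open>\<integral> (T t f) (\<phi> k) = \<integral> f (T t (\<phi> k))\<close>. The left-hand side increases to \<open>\<integral> T t f\<close>, and the right-hand side
converges by domination by \<open>f\<close>; the finite limit also shows that \<open>T t f\<close> is integrable.\<close>

lemma integral_T:
  assumes t: "0 < t" and f: "f \<in> L2 M" "integrable M f" "AE x in M. 0 \<le> f x"
  shows "integrable M (T t f)" "(\<integral>x. T t f x \<partial>M) = (\<integral>x. f x * one t x \<partial>M)"
proof -
  obtain \<phi> where \<phi>: "exhausting_sequence M \<phi>"
    and lim: "AE x in M. (\<forall>k. 0 \<le> T t (\<phi> k) x \<and> T t (\<phi> k) x \<le> 1) \<and> (\<lambda>k. T t (\<phi> k) x) \<longlonglongrightarrow> one t x"
    using one_limit[OF t] by blast
  note L = exhausting_L2[OF \<phi>]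
  have Tf: "T t f \<in> L2 M" "AE x in M. 0 \<le> T t f x"
    using T_L2[OF t f(1)] T_nonneg[OF t f(1,3)] by auto
  have \<phi>AE: "AE x in M. incseq (\<lambda>k. \<phi> k x) \<and> (\<lambda>k. \<phi> k x) \<longlonglongrightarrow> 1"
    using \<phi> unfolding exhausting_sequence_def by (auto elim: AE_mp)
  have "(\<lambda>k. \<integral>x. f x * T t (\<phi> k) x \<partial>M) \<longlonglongrightarrow> (\<integral>x. f x * one t x \<partial>M)"
  proof (rule integral_dominated_convergence[OF _ _ f(2)])
    show "(\<lambda>x. f x * one t x) \<in> borel_measurable M"
      using one_measurable[OF t] f(2) by auto
    show "(\<lambda>x. f x * T t (\<phi> k) x) \<in> borel_measurable M" for k
      using L2_measurable[OF T_L2[OF t L]] f(2) by auto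
    show "AE x in M. (\<lambda>k. f x * T t (\<phi> k) x) \<longlonglongrightarrow> f x * one t x"
      using lim by eventually_elim (auto intro: tendsto_mult_left)
    show "AE x in M. norm (f x * T t (\<phi> k) x) \<le> f x" for k
      using lim f(3) by eventually_elim (simp add: abs_mult mult_left_le)
  qed
  then have int_lim: "(\<lambda>k. \<integral>x. T t f x * \<phi> k x \<partial>M) \<longlonglongrightarrow> (\<integral>x. f x * one t x \<partial>M)"
    using T_symmetric[OF t f(1) L] by (simp add: L2_inner_def)
  have mono: "AE x in M. mono (\<lambda>k. T t f x * \<phi> k x)"
    using Tf(2) \<phi>AE by eventually_elim (auto simp: mono_def intro: mult_left_mono)
  have conv: "AE x in M. (\<lambda>k. T t f x * \<phi> k x) \<longlonglongrightarrow> T t f x"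
    using \<phi>AE by eventually_elim (use tendsto_mult_left in fastforce)
  note mc = L2_mult_integrable[OF Tf(1) L] mono conv int_lim L2_measurable[OF Tf(1)]
  show "integrable M (T t f)" by (rule integrable_monotone_convergence[OF mc])
  show "(\<integral>x. T t f x \<partial>M) = (\<integral>x. f x * one t x \<partial>M)"
    by (rule integral_monotone_convergence[OF mc])
qed

text \<open>The dual form of \<open>T t (one s) = one (s + t)\<close>, which avoids extending the semigroup to further bounded
functions.\<close>

lemma integral_T_one:
  assumes s: "0 < s" and t: "0 < t" and f: "f \<in> L2 M" "integrable M f" "AE x in M. 0 \<le> f x"
  shows "(\<integral>x. T t f x * one s x \<partial>M) = (\<integral>x. f x * one (s + t) x \<partial>M)"
proof -
  note Tf = T_L2[OF t f(1)] integral_T(1)[OF t f] T_nonneg[OF t f(1,3)]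
  have "(\<integral>x. T t f x * one s x \<partial>M) = (\<integral>x. T s (T t f) x \<partial>M)"
    by (rule integral_T(2)[OF s Tf, symmetric])
  also have "\<dots> = (\<integral>x. T (s + t) f x \<partial>M)"
  proof (rule integral_cong_AE)
    show "AE x in M. T s (T t f) x = T (s + t) f x"
      using T_semigroup[OF s t f(1)] by eventually_elim simp
  qed (use s t f in \<open>auto intro!: L2_measurable T_L2\<close>)
  also have "\<dots> = (\<integral>x. f x * one (s + t) x \<partial>M)"
    by (rule integral_T(2)) (use s t f in auto)
  finally show ?thesis .
qed

text \<open>Testing with \<open>f \<ge> 0\<close>: by duality \<open>\<integral> f (one t)\<close> is the mass of \<open>T t f\<close>, and running the semigroup for a further time
\<open>s\<close> cannot increase the mass.\<close>

lemma one_antimono: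
  assumes s: "0 < s" and t: "0 < t"
  shows "AE x in M. one (s + t) x \<le> one t x"
proof (rule AE_le_by_testing[OF sigma_finite])
  fix f assume f: "f \<in> L2 M" "integrable M f" "AE x in M. 0 \<le> f x"
  note Tf = integral_T(1)[OF t f] T_nonneg[OF t f(1,3)]
  have "(\<integral>x. f x * one (s + t) x \<partial>M) = (\<integral>x. T t f x * one s x \<partial>M)"
    by (rule integral_T_one[OF s t f, symmetric])
  also have "\<dots> \<le> (\<integral>x. T t f x \<partial>M)"
  proof (rule integral_mono_AE)
    show "integrable M (\<lambda>x. T t f x * one s x)"
      by (rule integrable_bounded_mult[OF Tf(1) one_measurable[OF s] one_unit[OF s]])
    show "AE x in M. T t f x * one s x \<le> T t f x"
      using Tf(2) one_unit[OF s] by eventually_elim (simp add: mult_left_le)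
  qed (rule Tf)
  also have "\<dots> = (\<integral>x. f x * one t x \<partial>M)" by (rule integral_T(2)[OF t f])
  finally show "(\<integral>x. f x * one (s + t) x \<partial>M) \<le> (\<integral>x. f x * one t x \<partial>M)" .
qed (use s t one_measurable one_unit in auto)

lemma X_cons_sets: "X_cons M T \<in> sets M"
proof -
  have "{x \<in> space M. one (real k) x = 1} \<in> sets M" if "1 \<le> k" for k
  proof -
    have [measurable]: "one (real k) \<in> borel_measurable M"
      by (rule one_measurable) (use that in simp)
    show ?thesis by measurable
  qed
  then have "(\<Inter>k\<in>{1..}. {x \<in> space M. one (real k) x = 1}) \<in> sets M"
    by (intro sets.countable_INT') auto
  also have "(\<Inter>k\<in>{1..}. {x \<in> space M. one (real k) x = 1}) = X_cons M T"
    by (auto simp: X_cons_def)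
  finally show ?thesis .
qed

text \<open>The set \<open>X_cons\<close> is defined by integer times. Monotonicity in time gives all real times, since every \<open>t\<close> is
followed by an integer.\<close>

lemma one_on_X_cons:
  assumes t: "0 < t"
  shows "AE x in M. x \<in> X_cons M T \<longrightarrow> one t x = 1"
proof -
  obtain k :: nat where k: "t < real k" using reals_Archimedean2 by blast
  have "AE x in M. one ((real k - t) + t) x \<le> one t x"
    by (rule one_antimono) (use k t in auto)
  then show ?thesis
    using one_unit[OF t]
  proof eventually_elim
    case (elim x)
    have "1 \<le> k" using k t by linarith
    then show ?case using elim by (force simp: X_cons_def)
  qed
qed

end

section \<open>Invariance of the conservative set\<close>

context sigma_finite_markov
begin

text \<open>No mass is lost from \<open>X_cons\<close>: with \<open>w\<close> supported there, \<open>\<integral> (T t w) (one k) = \<integral> w (one (k + t)) = \<integral> w\<close>,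
and \<open>\<integral> T t w\<close> has the same value. So \<open>T t w\<close> is carried by the set where \<open>one k = 1\<close>, for every \<open>k\<close>.\<close>

lemma T_vanishes_off_X_cons:
  assumes t: "0 < t" and w: "w \<in> L2 M" "integrable M w" "AE x in M. 0 \<le> w x"
    and off: "AE x in M. x \<notin> X_cons M T \<longrightarrow> w x = 0"
  shows "AE x in M. x \<notin> X_cons M T \<longrightarrow> T t w x = 0"
proof -
  note Tw = integral_T(1)[OF t w] T_nonneg[OF t w(1,3)]
  have "AE x in M. T t w x * (1 - one (real k) x) = 0" if k: "1 \<le> k" for k
  proof -
    have k0: "0 < real k" using k by simp
    have "(\<integral>x. T t w x * one (real k) x \<partial>M) = (\<integral>x. w x * one (real k + t) x \<partial>M)"
      by (rule integral_T_one[OF k0 t w])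
    also have "\<dots> = (\<integral>x. w x * one t x \<partial>M)"
    proof (rule integral_cong_AE)
      show "AE x in M. w x * one (real k + t) x = w x * one t x"
        using one_on_X_cons[OF t] one_on_X_cons[of "real k + t"] off t k0
        by (auto elim!: AE_mp)
    qed (use w one_measurable[OF t] one_measurable[of "real k + t"] t k0 in auto)
    also have "\<dots> = (\<integral>x. T t w x \<partial>M)" by (rule integral_T(2)[OF t w, symmetric])
    finally have eq: "(\<integral>x. T t w x * one (real k) x \<partial>M) = (\<integral>x. T t w x \<partial>M)" .
    have i: "integrable M (\<lambda>x. T t w x * one (real k) x)"
      by (rule integrable_bounded_mult[OF Tw(1) one_measurable[OF k0] one_unit[OF k0]])
    have nonneg: "AE x in M. 0 \<le> T t w x - T t w x * one (real k) x"
      using Tw(2) one_unit[OF k0] by eventually_elim (simp add: mult_left_le)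
    have "AE x in M. T t w x - T t w x * one (real k) x = 0"
      using integral_nonneg_eq_0_iff_AE[OF Bochner_Integration.integrable_diff[OF Tw(1) i] nonneg]
        eq Tw(1) i by simp
    then show ?thesis by (simp add: right_diff_distrib)
  qed
  then have "AE x in M. \<forall>k\<in>{1..}. T t w x * (1 - one (real k) x) = 0"
    by (subst AE_ball_countable) auto
  then show ?thesis
    using AE_space by eventually_elim (auto simp: X_cons_def)
qed

text \<open>No mass leaves \<open>X_cons\<close>, and by symmetry none enters it: the pairing of \<open>T t g\<close> with a function that is
strictly positive on \<open>X_cons\<close> and zero elsewhere vanishes for every nonnegative \<open>g\<close> supported in
\<open>X_diss\<close>. A single test function suffices, which must be integrable because mass arguments are
void for functions of infinite mass. A second use of symmetry removes integrability.\<close>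

lemma X_cons_invariant: "invariant_set M T (X_cons M T)"
proof -
  let ?Y = "X_cons M T"
  note Y = X_cons_sets
  obtain w where w: "w \<in> L2 M" "integrable M w" "AE x in M. 0 < w x"
    using positive_test_function[OF sigma_finite] by blast
  have pos: "AE x in M. x \<in> ?Y \<longrightarrow> T t g x = 0"
    if t: "0 < t" and g: "g \<in> L2 M" "AE x in M. 0 \<le> g x" "AE x in M. x \<in> ?Y \<longrightarrow> g x = 0" for t g
  proof -
    have f: "cut ?Y w \<in> L2 M" "integrable M (cut ?Y w)" "AE x in M. 0 \<le> cut ?Y w x"
      using L2_cut[OF Y w(1)] integrable_mult_indicator[OF Y w(2)] w(3)
      by (auto simp: cut_def elim!: AE_mp)
    have "AE x in M. x \<notin> ?Y \<longrightarrow> T t (cut ?Y w) x = 0"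
      by (rule T_vanishes_off_X_cons[OF t f]) (simp add: cut_def)
    then have "AE x in M. T t (cut ?Y w) x * g x = 0"
      using g(3) by eventually_elim auto
    then have "L2_inner M (T t (cut ?Y w)) g = 0"
      unfolding L2_inner_def by (rule integral_eq_zero_AE)
    then have int0: "(\<integral>x. cut ?Y w x * T t g x \<partial>M) = 0"
      using T_symmetric[OF t f(1) g(1)] by (simp add: L2_inner_def)
    have nonneg: "AE x in M. 0 \<le> cut ?Y w x * T t g x"
      using f(3) T_nonneg[OF t g(1,2)] by eventually_elim simp
    have "AE x in M. cut ?Y w x * T t g x = 0"
      using integral_nonneg_eq_0_iff_AE[OF L2_mult_integrable[OF f(1) T_L2[OF t g(1)]] nonneg] int0
      by simp
    then show ?thesis using w(3) by eventually_elim (auto simp: cut_def)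
  qed
  have off: "AE x in M. x \<in> ?Y \<longrightarrow> T t g x = 0"
    if t: "0 < t" and g: "g \<in> L2 M" and g0: "AE x in M. x \<in> ?Y \<longrightarrow> g x = 0" for t g
  proof -
    have a: "(\<lambda>x. \<bar>g x\<bar>) \<in> L2 M"
      by (rule L2_bound[OF g]) (use L2_measurable[OF g] in auto)
    have "AE x in M. x \<in> ?Y \<longrightarrow> T t (\<lambda>x. \<bar>g x\<bar>) x = 0"
      by (rule pos[OF t a]) (use g0 in auto)
    moreover have "AE x in M. T t g x \<le> T t (\<lambda>x. \<bar>g x\<bar>) x"
      by (rule T_mono[OF t g a]) auto
    moreover have "AE x in M. T t (\<lambda>x. -1 * g x) x \<le> T t (\<lambda>x. \<bar>g x\<bar>) x"
      by (rule T_mono[OF t L2_scale[OF g] a]) auto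
    moreover have "AE x in M. T t (\<lambda>x. -1 * g x) x = -1 * T t g x"
      by (rule T_scale[OF t g])
    ultimately show ?thesis by eventually_elim auto
  qed
  have "AE x in M. T t (cut ?Y u) x = cut ?Y (T t u) x" if t: "0 < t" and u: "u \<in> L2 M" for t u
  proof -
    let ?c = "\<lambda>u. \<lambda>x. u x - cut ?Y u x"
    have cu: "cut ?Y u \<in> L2 M" "?c u \<in> L2 M" using L2_cut[OF Y u] u by auto
    have Tcu: "T t (cut ?Y u) \<in> L2 M" by (rule T_L2[OF t cu(1)])
    \<comment> \<open>The part of \<open>T t (cut ?Y u)\<close> outside the conservative set; it is orthogonal to itself.\<close>
    define r where "r = ?c (T t (cut ?Y u))"
    have r: "r \<in> L2 M" unfolding r_def using Tcu L2_cut[OF Y Tcu] by auto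
    have "AE x in M. x \<in> ?Y \<longrightarrow> T t r x = 0"
      by (rule off[OF t r]) (simp add: r_def cut_def)
    then have "AE x in M. cut ?Y u x * T t r x = 0"
      by eventually_elim (auto simp: cut_def)
    then have "L2_inner M (cut ?Y u) (T t r) = 0"
      unfolding L2_inner_def by (rule integral_eq_zero_AE)
    then have "L2_inner M (T t (cut ?Y u)) r = 0"
      using T_symmetric[OF t cu(1) r] by simp
    also have "L2_inner M (T t (cut ?Y u)) r = L2_inner M r r"
      unfolding L2_inner_def
      by (rule Bochner_Integration.integral_cong) (auto simp: r_def cut_def indicator_def)
    finally have "AE x in M. r x = 0"
      using L2_norm_zero_imp_AE[OF r] by (simp add: L2_norm_def)
    moreover have "AE x in M. x \<in> ?Y \<longrightarrow> T t (?c u) x = 0"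
      by (rule off[OF t cu(2)]) (simp add: cut_def)
    moreover have "AE x in M. T t (\<lambda>x. cut ?Y u x + ?c u x) x = T t (cut ?Y u) x + T t (?c u) x"
      by (rule T_add[OF t cu])
    ultimately show ?thesis
      by eventually_elim (auto simp: r_def cut_def indicator_def)
  qed
  with Y show ?thesis by (simp add: invariant_set_def)
qed

end

section \<open>Restriction to a measurable subset\<close>

lemma borel_measurable_restrict_cut:
  "Y \<in> sets M \<Longrightarrow> u \<in> borel_measurable (restrict_space M Y) \<longleftrightarrow> cut Y u \<in> borel_measurable M"
  by (subst borel_measurable_restrict_space_iff) (auto simp: cut_def)

lemma integral_restrict_cut:
  "Y \<in> sets M \<Longrightarrow> (\<integral>x. u x \<partial>restrict_space M Y) = (\<integral>x. cut Y u x \<partial>M)"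
  by (subst integral_restrict_space) (auto simp: cut_def)

lemma integrable_restrict_cut:
  "Y \<in> sets M \<Longrightarrow> integrable (restrict_space M Y) u \<longleftrightarrow> integrable M (cut Y u)"
  by (subst integrable_restrict_space) (auto simp: cut_def)

lemma AE_restrict:
  "Y \<in> sets M \<Longrightarrow> (AE x in restrict_space M Y. P x) \<longleftrightarrow> (AE x in M. x \<in> Y \<longrightarrow> P x)"
  by (rule AE_restrict_space_iff) auto

lemma L2_restrict_cut: "Y \<in> sets M \<Longrightarrow> u \<in> L2 (restrict_space M Y) \<longleftrightarrow> cut Y u \<in> L2 M"
proof -
  have "cut Y (\<lambda>x. (u x)\<^sup>2) = (\<lambda>x. (cut Y u x)\<^sup>2)" by (auto simp: cut_def indicator_def)
  then show "Y \<in> sets M \<Longrightarrow> ?thesis"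
    by (simp add: L2_def borel_measurable_restrict_cut integrable_restrict_cut)
qed

lemma L2_inner_restrict_cut:
  "Y \<in> sets M \<Longrightarrow> L2_inner (restrict_space M Y) u v = L2_inner M (cut Y u) (cut Y v)"
proof -
  have "cut Y (\<lambda>x. u x * v x) = (\<lambda>x. cut Y u x * cut Y v x)" by (auto simp: cut_def indicator_def)
  then show "Y \<in> sets M \<Longrightarrow> ?thesis" by (simp add: L2_inner_def integral_restrict_cut)
qed

lemma L2_norm_restrict_cut: "Y \<in> sets M \<Longrightarrow> L2_norm (restrict_space M Y) u = L2_norm M (cut Y u)"
  by (simp add: L2_norm_def L2_inner_restrict_cut)

lemma cut_cong_AE:
  "AE x in M. x \<in> Y \<longrightarrow> u x = v x \<Longrightarrow> AE x in M. cut Y u x = cut Y v x"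
  by (erule AE_mp) (auto simp: cut_def indicator_def)

section \<open>The part of a form on an invariant set\<close>

text \<open>The form \<open>\<E>\<^sup>Y\<close> of the convention on parts. Cutting off is built into the value and not into the domain,
so that the parts on different sets share the domain of \<open>E\<close>.\<close>

definition part :: "'a form \<Rightarrow> 'a set \<Rightarrow> 'a form" where
  "part E Y = (\<lambda>u. if u \<in> dom E then E (cut Y u) else None)"

context markov_L2
begin

text \<open>Invariance makes \<open>T t (cut Y u)\<close> vanish outside \<open>Y\<close>, so nothing is lost when it is regarded as a
function on \<open>Y\<close>; this gives the semigroup law.\<close>

lemma restricted_semigroup:
  assumes inv: "invariant_set M T Y"
  shows "markov_semigroup (restrict_space M Y) (\<lambda>t u. T t (cut Y u))"
proof -
  have Y: "Y \<in> sets M" using inv by (simp add: invariant_set_def)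
  have I: "AE x in M. T t (cut Y u) x = cut Y (T t u) x" if "0 < t" "u \<in> L2 M" for t u
    using inv that by (simp add: invariant_set_def)
  have I': "AE x in M. cut Y (T t (cut Y u)) x = T t (cut Y u) x" if "0 < t" "cut Y u \<in> L2 M" for t u
    using I[OF that] by eventually_elim simp
  note rs = borel_measurable_restrict_cut[OF Y] L2_restrict_cut[OF Y]
    L2_inner_restrict_cut[OF Y] L2_norm_restrict_cut[OF Y] AE_restrict[OF Y]
  have m: "u \<in> L2 M \<Longrightarrow> cut Y u \<in> borel_measurable M" "u \<in> L2 M \<Longrightarrow> u \<in> borel_measurable M" for u
    using cut_measurable[OF Y] L2_measurable by blast+
  show ?thesis
    unfolding markov_semigroup_def
  proof (intro conjI allI impI ballI; unfold rs)
    fix t :: real assume t: "0 < t"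
    fix u assume u: "cut Y u \<in> L2 M"
    show "cut Y (T t (cut Y u)) \<in> L2 M" by (rule L2_cut[OF Y T_L2[OF t u]])
    show "AE x in M. x \<in> Y \<longrightarrow> T t (cut Y (\<lambda>y. c * u y)) x = c * T t (cut Y u) x" for c
      using T_scale[OF t u, of c] unfolding cut_scale by eventually_elim simp
    have "L2_norm M (cut Y (T t (cut Y u))) \<le> L2_norm M (T t (cut Y u))"
      by (rule L2_norm_cut_le[OF Y T_L2[OF t u]])
    also have "\<dots> \<le> L2_norm M (cut Y u)" by (rule T_contraction[OF t u])
    finally show "L2_norm M (cut Y (T t (cut Y u))) \<le> L2_norm M (cut Y u)" .
    fix v assume v: "cut Y v \<in> L2 M"
    show "AE x in M. x \<in> Y \<longrightarrow> T t (cut Y (\<lambda>y. u y + v y)) x = T t (cut Y u) x + T t (cut Y v) x"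
      using T_add[OF t u v] unfolding cut_add by eventually_elim simp
    show "L2_inner M (cut Y (T t (cut Y u))) (cut Y v) = L2_inner M (cut Y u) (cut Y (T t (cut Y v)))"
      using T_symmetric[OF t u v] by (simp add: L2_inner_cut_left)
    assume "AE x in M. x \<in> Y \<longrightarrow> u x = v x"
    from T_cong_AE[OF t u v cut_cong_AE[OF this]]
    show "AE x in M. x \<in> Y \<longrightarrow> T t (cut Y u) x = T t (cut Y v) x"
      by eventually_elim simp
  next
    fix s t :: real assume s: "0 < s" and t: "0 < t"
    fix u assume u: "cut Y u \<in> L2 M"
    have "AE x in M. T s (cut Y (T t (cut Y u))) x = T s (T t (cut Y u)) x"
      by (rule T_cong_AE[OF s L2_cut[OF Y T_L2[OF t u]] T_L2[OF t u] I'[OF t u]])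
    then show "AE x in M. x \<in> Y \<longrightarrow> T (s + t) (cut Y u) x = T s (cut Y (T t (cut Y u))) x"
      using T_semigroup[OF s t u] by eventually_elim simp
  next
    fix u assume u: "cut Y u \<in> L2 M"
    show "((\<lambda>t. L2_norm M (cut Y (\<lambda>x. T t (cut Y u) x - u x))) \<longlongrightarrow> 0) (at_right 0)"
    proof (rule Lim_null_comparison[OF _ T_continuous[OF u]])
      show "\<forall>\<^sub>F t in at_right 0. norm (L2_norm M (cut Y (\<lambda>x. T t (cut Y u) x - u x)))
          \<le> L2_norm M (\<lambda>x. T t (cut Y u) x - cut Y u x)"
        unfolding eventually_at_right_field
      proof (intro exI[of _ 1] conjI allI impI)
        fix t :: real assume "0 < t"
        have "cut Y (\<lambda>x. T t (cut Y u) x - u x) = cut Y (\<lambda>x. T t (cut Y u) x - cut Y u x)"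
          by (simp add: cut_diff)
        then show "norm (L2_norm M (cut Y (\<lambda>x. T t (cut Y u) x - u x)))
            \<le> L2_norm M (\<lambda>x. T t (cut Y u) x - cut Y u x)"
          using L2_norm_cut_le[OF Y L2_diff[OF T_L2[OF \<open>0 < t\<close> u] u]] by (simp add: L2_norm_nonneg)
      qed simp
    qed
  next
    fix t :: real assume t: "0 < t"
    fix u assume u: "cut Y u \<in> L2 M" and unit: "AE x in M. x \<in> Y \<longrightarrow> 0 \<le> u x \<and> u x \<le> 1"
    have "AE x in M. 0 \<le> T t (cut Y u) x \<and> T t (cut Y u) x \<le> 1"
      by (rule T_unit[OF t u]) (use unit in eventually_elim, auto simp: cut_def indicator_def)
    then show "AE x in M. x \<in> Y \<longrightarrow> 0 \<le> T t (cut Y u) x \<and> T t (cut Y u) x \<le> 1"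
      by eventually_elim simp
  qed
qed

end

text \<open>Both functions satisfy the duality \<open>\<integral> f h = \<integral> T t (cut Y f)\<close> on \<open>Y\<close>, and this determines them. So they agree although
the exhausting sequences chosen on the two measure spaces are unrelated.\<close>

lemma (in sigma_finite_markov) one_restricted:
  assumes inv: "invariant_set M T Y" and t: "0 < t"
  shows "AE x in restrict_space M Y.
    Linf_extension (restrict_space M Y) (\<lambda>t u. T t (cut Y u)) t (\<lambda>_. 1) x = one t x"
proof -
  have Y: "Y \<in> sets M" using inv by (simp add: invariant_set_def)
  let ?N = "restrict_space M Y"
  interpret N: sigma_finite_markov ?N "\<lambda>t u. T t (cut Y u)"
    by (intro sigma_finite_markov.intro markov_L2.intro sigma_finite_markov_axioms.intro
        restricted_semigroup[OF inv] sigma_finite_measure_restrict_space[OF sigma_finite Y])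
  have m: "one t \<in> borel_measurable ?N"
    using one_measurable[OF t] by (rule measurable_restrict_space1)
  have unit: "AE x in ?N. 0 \<le> one t x \<and> one t x \<le> 1"
    unfolding AE_restrict[OF Y] using one_unit[OF t] by eventually_elim simp
  have eq: "(\<integral>x. f x * N.one t x \<partial>?N) = (\<integral>x. f x * one t x \<partial>?N)"
    if f: "f \<in> L2 ?N" "integrable ?N f" "AE x in ?N. 0 \<le> f x" for f
  proof -
    have f': "cut Y f \<in> L2 M" "integrable M (cut Y f)" "AE x in M. 0 \<le> cut Y f x"
    proof -
      show "AE x in M. 0 \<le> cut Y f x"
        using f(3) unfolding AE_restrict[OF Y] by eventually_elim (auto simp: cut_def indicator_def)
    qed (use f L2_restrict_cut[OF Y] integrable_restrict_cut[OF Y] in auto)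
    have "(\<integral>x. f x * N.one t x \<partial>?N) = (\<integral>x. T t (cut Y f) x \<partial>?N)"
      by (rule N.integral_T(2)[OF t f, symmetric])
    also have "\<dots> = (\<integral>x. cut Y (T t (cut Y f)) x \<partial>M)" by (rule integral_restrict_cut[OF Y])
    also have "\<dots> = (\<integral>x. T t (cut Y f) x \<partial>M)"
    proof (rule integral_cong_AE)
      have "AE x in M. T t (cut Y (cut Y f)) x = cut Y (T t (cut Y f)) x"
        using inv t f'(1) by (simp only: invariant_set_def)
      then show "AE x in M. cut Y (T t (cut Y f)) x = T t (cut Y f) x"
        by eventually_elim simp
    qed (use L2_measurable[OF T_L2[OF t f'(1)]] cut_measurable[OF Y] in auto)
    also have "\<dots> = (\<integral>x. cut Y f x * one t x \<partial>M)" by (rule integral_T(2)[OF t f'])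
    also have "\<dots> = (\<integral>x. f x * one t x \<partial>?N)"
      by (simp add: integral_restrict_cut[OF Y]) (simp add: cut_def mult.assoc)
    finally show ?thesis .
  qed
  have "AE x in ?N. N.one t x \<le> one t x"
    by (rule AE_le_by_testing[OF N.sigma_finite N.one_measurable[OF t] N.one_unit[OF t] m unit])
      (simp add: eq)
  moreover have "AE x in ?N. one t x \<le> N.one t x"
    by (rule AE_le_by_testing[OF N.sigma_finite m unit N.one_measurable[OF t] N.one_unit[OF t]])
      (simp add: eq)
  ultimately show ?thesis by eventually_elim simp
qed

context form_with_semigroup
begin

lemma part_dom:
  assumes "invariant_set M T Y"
  shows "dom (part E Y) = dom E"
  using cut_in_dom[OF assms, unfolded domIff]
  by (auto simp: part_def domIff set_eq_iff simp del: not_None_eq)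

lemma part_in_L2_of:
  assumes "invariant_set M T Y"
  shows "as_form_in_L2_of Y (part E Y) = (\<lambda>v. E (cut Y v))"
proof
  fix v show "as_form_in_L2_of Y (part E Y) v = E (cut Y v)"
    by (cases "cut Y v \<in> dom E") (auto simp: as_form_in_L2_of_def part_def domIff simp del: not_None_eq)
qed

lemma form_on_part:
  assumes "invariant_set M T Y"
  shows "form_on Y (part E Y)"
  using cut_in_dom[OF assms] by (auto simp: form_on_def part_def split: if_splits)

text \<open>The splitting of the form carries this contraction property from the core to the whole form domain.\<close>

lemma cut_form_norm_le:
  assumes inv: "invariant_set M T Y" and u: "u \<in> dom E"
  shows "form_norm M E (cut Y u) \<le> form_norm M E u"
proof -
  have Y: "Y \<in> sets M" using inv by (simp add: invariant_set_def)
  have "(L2_norm M (cut Y u))\<^sup>2 \<le> (L2_norm M u)\<^sup>2"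
    using L2_norm_cut_le[OF Y dom_L2[OF u]] L2_norm_nonneg by (intro power_mono)
  then show ?thesis
    using form_split[OF inv u] form_nonneg[OF cut_in_dom[OF invariant_compl[OF inv space] u]]
    by (simp add: form_norm_def)
qed

text \<open>Covers the part of \<open>E\<close> on all of its domain, on the functions vanishing outside \<open>Y\<close>, and on \<open>Y\<close> as a
measure space of its own: in each case the polar form is the one of \<open>E\<close> at the functions cut off to \<open>Y\<close>.\<close>

lemma quadratic_form_of_cut:
  assumes L2: "dom Q \<subseteq> L2 N"
    and cong: "\<And>u v. u \<in> dom Q \<Longrightarrow> v \<in> borel_measurable N \<Longrightarrow> AE x in N. u x = v x \<Longrightarrow> Q v = Q u"
    and zero: "(\<lambda>_. 0) \<in> dom Q"
    and add: "\<And>u v. u \<in> dom Q \<Longrightarrow> v \<in> dom Q \<Longrightarrow> (\<lambda>x. u x + v x) \<in> dom Q"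
    and scale: "\<And>c u. u \<in> dom Q \<Longrightarrow> (\<lambda>x. c * u x) \<in> dom Q"
    and cut: "\<And>u. u \<in> dom Q \<Longrightarrow> cut Y u \<in> dom E" "\<And>u. u \<in> dom Q \<Longrightarrow> Q u = E (cut Y u)"
  shows "quadratic_form N Q"
proof -
  have "\<exists>a. (\<forall>u\<in>dom Q. \<forall>v\<in>dom Q. a u v = a v u) \<and>
          (\<forall>u\<in>dom Q. \<forall>v\<in>dom Q. \<forall>w\<in>dom Q. a (\<lambda>x. u x + v x) w = a u w + a v w) \<and>
          (\<forall>c. \<forall>u\<in>dom Q. \<forall>v\<in>dom Q. a (\<lambda>x. c * u x) v = c * a u v) \<and>
          (\<forall>u\<in>dom Q. the (Q u) = a u u)"
    by (rule exI[of _ "\<lambda>u v. polar E (cut Y u) (cut Y v)"])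
      (use cut in \<open>auto simp: cut_add cut_scale polar_add_left polar_scale_left polar_commute polar_self
        simp del: domIff\<close>)
  then show ?thesis
    unfolding quadratic_form_def
    using L2 cong zero add scale cut form_nonneg by (intro conjI ballI allI impI) (auto simp del: domIff)
qed

lemma part_quadratic:
  assumes inv: "invariant_set M T Y"
  shows "quadratic_form M (part E Y)"
proof -
  have Y: "Y \<in> sets M" using inv by (simp add: invariant_set_def)
  show ?thesis
  proof (rule quadratic_form_of_cut[where Y = Y]; (unfold part_dom[OF inv])?)
    fix u v assume u: "u \<in> dom E" and v: "v \<in> borel_measurable M" and eq: "AE x in M. u x = v x"
    have "v \<in> dom E" by (rule dom_cong_AE[OF u v eq])
    moreover have "E (cut Y v) = E (cut Y u)"
      by (rule form_cong_AE[OF cut_in_dom[OF inv u] cut_measurable[OF Y v]])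
        (use eq in eventually_elim, simp add: cut_def)
    ultimately show "part E Y v = part E Y u" using u by (simp add: part_def)
  qed (use dom_L2 cut_in_dom[OF inv] in \<open>auto simp: part_def simp del: domIff\<close>)
qed

text \<open>The two readings of a part as a form differ only in the measure space \<open>N\<close>. For \<open>N = M\<close> the condition
\<open>u = cut Y u\<close> selects the functions vanishing outside \<open>Y\<close>; for \<open>N = restrict_space M Y\<close> it holds for every
function. In both cases \<open>cut Y\<close> is an isometry into the form domain of \<open>E\<close> that commutes with the truncation to \<open>[0, 1]\<close>, and
a limit of functions cut off to \<open>Y\<close> may itself be cut off, by contractivity of \<open>cut Y\<close> in the form norm.\<close>

lemma wide_dirichlet_form_of_cut:
  assumes wide: "wide_dirichlet_form M E" and inv: "invariant_set M T Y"
    and N: "N = M \<or> N = restrict_space M Y"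
    and Q: "Q = (\<lambda>u. if u \<in> borel_measurable N \<and> cut Y u \<in> dom E \<and> (AE x in N. u x = cut Y u x)
                  then E (cut Y u) else None)"
  shows "wide_dirichlet_form N Q"
proof -
  have Y: "Y \<in> sets M" using inv by (simp add: invariant_set_def)
  have dom_Q: "dom Q = {u \<in> borel_measurable N. cut Y u \<in> dom E \<and> (AE x in N. u x = cut Y u x)}"
    by (auto simp: Q split: if_splits)
  have Q_cut: "Q u = E (cut Y u)" if "u \<in> dom Q" for u
    using that unfolding dom_Q by (simp add: Q)
  have cutN: "cut Y u \<in> borel_measurable N" if "cut Y u \<in> borel_measurable M" for u
    using N that by (auto intro: measurable_restrict_space1)
  have AE_N: "AE x in M. cut Y u x = cut Y v x" if "AE x in N. u x = v x" for u v
    using N that by (auto simp: AE_restrict[OF Y] cut_def indicator_def elim!: AE_mp)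
  have norm_eq: "L2_norm N u = L2_norm M (cut Y u)" and L2_N: "u \<in> L2 N"
    if "u \<in> borel_measurable N" "cut Y u \<in> L2 M" "AE x in N. u x = cut Y u x" for u
  proof -
    show "L2_norm N u = L2_norm M (cut Y u)"
      using N
    proof
      assume "N = M"
      then show ?thesis using that L2_norm_cong_AE[of u M "cut Y u"] by (blast intro: L2_measurable)
    qed (simp add: L2_norm_restrict_cut[OF Y])
    show "u \<in> L2 N"
      using N
    proof
      assume "N = M"
      have "AE x in M. cut Y u x = u x"
        using that(3) unfolding \<open>N = M\<close> by eventually_elim simp
      then show ?thesis using that L2_cong_AE[of "cut Y u" M u] \<open>N = M\<close> by blast
    qed (simp add: L2_restrict_cut[OF Y] that)
  qed
  have dom_add_Q: "(\<lambda>x. u x + v x) \<in> dom Q" if "u \<in> dom Q" "v \<in> dom Q" for u v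
  proof -
    have "AE x in N. u x = cut Y u x" "AE x in N. v x = cut Y v x"
      using that unfolding dom_Q by auto
    then have "AE x in N. u x + v x = cut Y u x + cut Y v x" by eventually_elim simp
    then show ?thesis using that unfolding dom_Q by (auto simp: cut_add simp del: domIff)
  qed
  have dom_scale_Q: "(\<lambda>x. c * u x) \<in> dom Q" if "u \<in> dom Q" for c u
  proof -
    have "AE x in N. u x = cut Y u x" using that unfolding dom_Q by auto
    then have "AE x in N. c * u x = c * cut Y u x" by eventually_elim simp
    then show ?thesis using that unfolding dom_Q by (auto simp: cut_scale simp del: domIff)
  qed
  have "quadratic_form N Q"
  proof (rule quadratic_form_of_cut[where Y = Y])
    show "dom Q \<subseteq> L2 N" using L2_N dom_L2 unfolding dom_Q by blast
    show "(\<lambda>_. 0) \<in> dom Q" unfolding dom_Q by (auto simp del: domIff)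
    fix u v assume u: "u \<in> dom Q" and v: "v \<in> borel_measurable N" and eq: "AE x in N. u x = v x"
    have uD: "cut Y u \<in> dom E" and uN: "AE x in N. u x = cut Y u x" using u unfolding dom_Q by auto
    have cvM: "cut Y v \<in> borel_measurable M"
      using N v by (auto simp: borel_measurable_restrict_cut[OF Y] intro: cut_measurable[OF Y])
    have vE: "E (cut Y v) = E (cut Y u)"
      by (rule form_cong_AE[OF uD cvM AE_N[OF eq]])
    have "AE x in N. v x = cut Y v x"
      using N
    proof
      assume "N = M"
      then show ?thesis using uN eq by (auto simp: cut_def indicator_def elim!: AE_mp)
    next
      assume "N = restrict_space M Y"
      then show ?thesis by (simp only: AE_restrict[OF Y]) (simp add: cut_def)
    qed
    then show "Q v = Q u"
      using v vE uD Q_cut[OF u] by (simp add: Q domIff)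
  qed (use dom_add_Q dom_scale_Q Q_cut in \<open>auto simp: dom_Q simp del: domIff\<close>)
  moreover have "closed_form N Q"
    unfolding closed_form_def
  proof (intro allI impI, elim conjE)
    fix u :: "nat \<Rightarrow> 'a \<Rightarrow> real"
    assume u: "\<forall>n. u n \<in> dom Q"
      and cauchy: "\<forall>e>0. \<exists>N'. \<forall>m\<ge>N'. \<forall>n\<ge>N'. form_norm N Q (\<lambda>x. u m x - u n x) < e"
    have dom_diff_Q: "(\<lambda>x. v x - w x) \<in> dom Q" if "v \<in> dom Q" "w \<in> dom Q" for v w
      using dom_add_Q[OF that(1) dom_scale_Q[OF that(2), of "-1"]] by simp
    have form_norm_Q: "form_norm N Q v = form_norm M E (cut Y v)" if v: "v \<in> dom Q" for v
      using norm_eq[of v] Q_cut[OF v] v dom_L2 unfolding dom_Q by (simp add: form_norm_def)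
    have cuD: "cut Y (u n) \<in> dom E" for n using u unfolding dom_Q by blast
    have "form_norm N Q (\<lambda>x. u m x - u n x) = form_norm M E (\<lambda>x. cut Y (u m) x - cut Y (u n) x)" for m n
      using form_norm_Q[OF dom_diff_Q] u by (simp add: cut_diff)
    then obtain w where w: "w \<in> dom E" "(\<lambda>n. form_norm M E (\<lambda>x. cut Y (u n) x - w x)) \<longlonglongrightarrow> 0"
      using closed[unfolded closed_form_def, THEN spec, of "\<lambda>n. cut Y (u n)"] cuD cauchy by auto
    have cwD: "cut Y w \<in> dom Q"
      using cut_in_dom[OF inv w(1)] cutN[OF L2_measurable[OF dom_L2]] unfolding dom_Q by simp
    have le: "form_norm N Q (\<lambda>x. u n x - cut Y w x) \<le> form_norm M E (\<lambda>x. cut Y (u n) x - w x)" for n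
      using cut_form_norm_le[OF inv dom_diff[OF cuD w(1)], of n] form_norm_Q[OF dom_diff_Q[OF _ cwD], of "u n"] u
      by (simp add: cut_diff)
    have "(\<lambda>n. form_norm N Q (\<lambda>x. u n x - cut Y w x)) \<longlonglongrightarrow> 0"
    proof (rule Lim_null_comparison[OF _ w(2)], intro always_eventually allI)
      fix n
      have "0 \<le> form_norm N Q (\<lambda>x. u n x - cut Y w x)"
        using form_norm_Q[OF dom_diff_Q[OF _ cwD], of "u n"] u
          form_norm_nonneg[OF dom_diff[OF cuD cut_in_dom[OF inv w(1)]]] by (simp add: cut_diff)
      then show "norm (form_norm N Q (\<lambda>x. u n x - cut Y w x)) \<le> form_norm M E (\<lambda>x. cut Y (u n) x - w x)"
        using le by simp
    qed
    with cwD show "\<exists>w\<in>dom Q. (\<lambda>n. form_norm N Q (\<lambda>x. u n x - w x)) \<longlonglongrightarrow> 0" by blast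
  qed
  moreover have "(\<lambda>x. min (max (u x) 0) 1) \<in> dom Q \<and> the (Q (\<lambda>x. min (max (u x) 0) 1)) \<le> the (Q u)"
    if u: "u \<in> dom Q" for u
  proof -
    let ?c = "\<lambda>u x. min (max (u x) 0) (1 :: real)"
    have c: "cut Y (?c u) = ?c (cut Y u)" by (auto simp: cut_def indicator_def)
    have uN: "u \<in> borel_measurable N" "cut Y u \<in> dom E" "AE x in N. u x = cut Y u x"
      using u unfolding dom_Q by auto
    have E: "?c (cut Y u) \<in> dom E" "the (E (?c (cut Y u))) \<le> the (E (cut Y u))"
      using wide uN(2) unfolding wide_dirichlet_form_def by blast+
    have "AE x in N. ?c u x = ?c (cut Y u) x" using uN(3) by eventually_elim simp
    then have cD: "?c u \<in> dom Q" unfolding dom_Q using uN(1) E(1) c by simp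
    then show ?thesis using E(2) by (simp only: Q_cut[OF cD] Q_cut[OF u] c)
  qed
  ultimately show ?thesis unfolding wide_dirichlet_form_def by blast
qed

lemma part_in_L2:
  assumes inv: "invariant_set M T Y"
  shows "as_form_in_L2 M Y (part E Y) =
    (\<lambda>u. if u \<in> borel_measurable M \<and> cut Y u \<in> dom E \<and> (AE x in M. u x = cut Y u x)
         then E (cut Y u) else None)"
proof
  fix u
  have AE: "(AE x in M. x \<notin> Y \<longrightarrow> u x = 0) \<longleftrightarrow> (AE x in M. u x = cut Y u x)"
    by (rule AE_cong) (auto simp: cut_def indicator_def)
  have "u \<in> dom E \<longleftrightarrow> u \<in> borel_measurable M \<and> cut Y u \<in> dom E"
    if eq: "AE x in M. u x = cut Y u x"
  proof -
    have "AE x in M. cut Y u x = u x" using eq by eventually_elim simp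
    then show ?thesis
      using dom_cong_AE[of "cut Y u" u] cut_in_dom[OF inv] L2_measurable[OF dom_L2] by blast
  qed
  then show "as_form_in_L2 M Y (part E Y) u =
    (if u \<in> borel_measurable M \<and> cut Y u \<in> dom E \<and> (AE x in M. u x = cut Y u x)
     then E (cut Y u) else None)"
    unfolding as_form_in_L2_def restrict_map_def part_def using AE by simp
qed

lemma part_in_L2_wide_dirichlet:
  assumes "wide_dirichlet_form M E" "invariant_set M T Y"
  shows "wide_dirichlet_form M (as_form_in_L2 M Y (part E Y))"
  by (rule wide_dirichlet_form_of_cut[OF assms, of M]) (simp_all add: part_in_L2 assms)

text \<open>Density survives because an approximation in \<open>L\<^sup>2\<close> of the extension by zero is, on \<open>Y\<close>, at least as
good an approximation of the function itself.\<close>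

lemma part_dirichlet:
  assumes E: "dirichlet_form M E" and inv: "invariant_set M T Y"
  shows "dirichlet_form (restrict_space M Y) (as_form_in_L2_of Y (part E Y))"
  unfolding dirichlet_form_def part_in_L2_of[OF inv]
proof
  have Y: "Y \<in> sets M" using inv by (simp add: invariant_set_def)
  let ?N = "restrict_space M Y"
  have as_cut: "(\<lambda>v. E (cut Y v)) = (\<lambda>u. if u \<in> borel_measurable ?N \<and> cut Y u \<in> dom E \<and>
      (AE x in ?N. u x = cut Y u x) then E (cut Y u) else None)"
  proof
    fix v
    have "cut Y v \<in> dom E \<Longrightarrow> v \<in> borel_measurable ?N"
      using L2_measurable[OF dom_L2] by (simp add: borel_measurable_restrict_cut[OF Y])
    moreover have "AE x in ?N. v x = cut Y v x"
      by (simp only: AE_restrict[OF Y]) (simp add: cut_def)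
    ultimately show "E (cut Y v) = (if v \<in> borel_measurable ?N \<and> cut Y v \<in> dom E \<and>
        (AE x in ?N. v x = cut Y v x) then E (cut Y v) else None)"
      by (cases "cut Y v \<in> dom E") (simp_all add: domIff del: not_None_eq)
  qed
  have "wide_dirichlet_form M E" using E by (simp add: dirichlet_form_def)
  from wide_dirichlet_form_of_cut[OF this inv disjI2[OF refl] as_cut]
  show "wide_dirichlet_form ?N (\<lambda>v. E (cut Y v))" .
  show "densely_defined ?N (\<lambda>v. E (cut Y v))"
    unfolding densely_defined_def
  proof (intro ballI allI impI)
    fix u and e :: real assume u: "u \<in> L2 ?N" and e: "0 < e"
    have cu: "cut Y u \<in> L2 M" using u by (simp add: L2_restrict_cut[OF Y])
    obtain w where w: "w \<in> dom E" "L2_norm M (\<lambda>x. cut Y u x - w x) < e"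
      using E cu e unfolding dirichlet_form_def densely_defined_def by blast
    have "L2_norm ?N (\<lambda>x. u x - w x) = L2_norm M (cut Y (\<lambda>x. cut Y u x - w x))"
      by (simp add: L2_norm_restrict_cut[OF Y] cut_diff)
    also have "\<dots> \<le> L2_norm M (\<lambda>x. cut Y u x - w x)"
      by (rule L2_norm_cut_le[OF Y L2_diff[OF cu dom_L2[OF w(1)]]])
    finally have "L2_norm ?N (\<lambda>x. u x - w x) < e" using w(2) by simp
    moreover have "w \<in> dom (\<lambda>v. E (cut Y v))"
      using cut_in_dom[OF inv w(1)] by (simp add: domIff)
    ultimately show "\<exists>v\<in>dom (\<lambda>v. E (cut Y v)). L2_norm ?N (\<lambda>x. u x - v x) < e" by blast
  qed
qed

text \<open>Difference quotients on \<open>Y\<close> agree with those of the extension by zero, so the generator is described by the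
form \<open>E\<close> at \<open>cut Y u\<close>. There it makes no difference whether all \<open>v\<close> in the domain are tested or only those
supported in \<open>Y\<close>, since \<open>cut Y u\<close> is orthogonal to \<open>cut (- Y) v\<close>.\<close>

lemma part_associated:
  assumes inv: "invariant_set M T Y"
  shows "associated_semigroup (restrict_space M Y) (as_form_in_L2_of Y (part E Y))
    (\<lambda>t u. T t (cut Y u))"
  unfolding associated_semigroup_def part_in_L2_of[OF inv]
proof (intro conjI ballI)
  have Y: "Y \<in> sets M" using inv by (simp add: invariant_set_def)
  let ?N = "restrict_space M Y" and ?E = "\<lambda>v. E (cut Y v)"
  show "markov_semigroup ?N (\<lambda>t u. T t (cut Y u))" by (rule restricted_semigroup[OF inv])
  fix u f assume "u \<in> L2 ?N" "f \<in> L2 ?N"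
  then have u: "cut Y u \<in> L2 M" and f: "cut Y f \<in> L2 M" by (simp_all add: L2_restrict_cut[OF Y])
  have norm: "L2_norm ?N (\<lambda>x. (u x - T t (cut Y u) x) / t - f x) =
      L2_norm M (\<lambda>x. (cut Y u x - T t (cut Y u) x) / t - cut Y f x)" if t: "0 < t" for t
    unfolding L2_norm_restrict_cut[OF Y]
  proof (rule L2_norm_cong_AE)
    have Tu: "T t (cut Y u) \<in> borel_measurable M" by (rule L2_measurable[OF T_L2[OF t u]])
    then show m: "(\<lambda>x. (cut Y u x - T t (cut Y u) x) / t - cut Y f x) \<in> borel_measurable M"
      using L2_measurable[OF u] L2_measurable[OF f] by simp
    have "cut Y (\<lambda>x. (u x - T t (cut Y u) x) / t - f x) =
        cut Y (\<lambda>x. (cut Y u x - T t (cut Y u) x) / t - cut Y f x)"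
      by (auto simp: cut_def indicator_def)
    then show "cut Y (\<lambda>x. (u x - T t (cut Y u) x) / t - f x) \<in> borel_measurable M"
      using cut_measurable[OF Y m] by simp
    have "AE x in M. T t (cut Y (cut Y u)) x = cut Y (T t (cut Y u)) x"
      using inv t u by (simp only: invariant_set_def)
    then have "AE x in M. T t (cut Y u) x = cut Y (T t (cut Y u)) x" by simp
    then show "AE x in M. cut Y (\<lambda>x. (u x - T t (cut Y u) x) / t - f x) x
        = (cut Y u x - T t (cut Y u) x) / t - cut Y f x"
      by eventually_elim (auto simp: cut_def indicator_def)
  qed
  have polar: "polar ?E u v = polar E (cut Y u) (cut Y v)" for v
    by (simp add: polar_def cut_add cut_diff)
  have "((\<lambda>t. L2_norm ?N (\<lambda>x. (u x - T t (cut Y u) x) / t - f x)) \<longlongrightarrow> 0) (at_right 0) \<longleftrightarrow>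
      ((\<lambda>t. L2_norm M (\<lambda>x. (cut Y u x - T t (cut Y u) x) / t - cut Y f x)) \<longlongrightarrow> 0) (at_right 0)"
    by (rule tendsto_cong) (use norm in \<open>auto simp: eventually_at_right_field intro: exI[of _ 1]\<close>)
  also have "\<dots> \<longleftrightarrow> cut Y u \<in> dom E \<and> (\<forall>v\<in>dom E. polar E (cut Y u) v = L2_inner M (cut Y f) v)"
    by (rule generator_iff[OF u f])
  also have "\<dots> \<longleftrightarrow> u \<in> dom ?E \<and> (\<forall>v\<in>dom ?E. polar ?E u v = L2_inner ?N f v)"
  proof (rule conj_cong)
    show "cut Y u \<in> dom E \<longleftrightarrow> u \<in> dom ?E" by (simp add: domIff)
    assume uE: "u \<in> dom ?E"
    then have cu: "cut Y u \<in> dom E" by (simp add: domIff)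
    show "(\<forall>v\<in>dom E. polar E (cut Y u) v = L2_inner M (cut Y f) v) \<longleftrightarrow>
        (\<forall>v\<in>dom ?E. polar ?E u v = L2_inner ?N f v)"
    proof (intro iffI ballI)
      fix v assume *: "\<forall>v\<in>dom E. polar E (cut Y u) v = L2_inner M (cut Y f) v" and "v \<in> dom ?E"
      then have "cut Y v \<in> dom E" by (simp add: domIff)
      with * show "polar ?E u v = L2_inner ?N f v"
        by (simp add: polar L2_inner_restrict_cut[OF Y])
    next
      fix v assume *: "\<forall>v\<in>dom ?E. polar ?E u v = L2_inner ?N f v" and v: "v \<in> dom E"
      have "v \<in> dom ?E" using cut_in_dom[OF inv v] by (simp add: domIff)
      then have "polar E (cut Y u) (cut Y v) = L2_inner M (cut Y f) (cut Y v)"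
        using * by (simp add: polar L2_inner_restrict_cut[OF Y])
      also have "\<dots> = L2_inner M (cut Y f) v" by (simp flip: L2_inner_cut_left)
      finally show "polar E (cut Y u) v = L2_inner M (cut Y f) v"
        using polar_cut_left[OF inv cu v] by simp
    qed
  qed
  finally show "((\<lambda>t. L2_norm ?N (\<lambda>x. (u x - T t (cut Y u) x) / t - f x)) \<longlongrightarrow> 0) (at_right 0) \<longleftrightarrow>
      u \<in> dom ?E \<and> (\<forall>v\<in>dom ?E. polar ?E u v = L2_inner ?N f v)" .
qed

text \<open>At \<open>cut Y u\<close> the form \<open>R\<close> vanishes, as it takes the same value there as at \<open>cut (- Y) (cut Y u) = 0\<close>.\<close>

lemma part_unique:
  assumes Q: "dom Q = dom E" "form_on Y Q"
    and R: "quadratic_form M R" "dom R = dom E" "form_on (- Y) R"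
    and sum: "\<And>u. u \<in> dom E \<Longrightarrow> the (E u) = the (Q u) + the (R u)"
  shows "Q = part E Y"
proof
  fix u
  show "Q u = part E Y u"
  proof (cases "u \<in> dom E")
    case False
    then have "Q u = None" unfolding Q(1)[symmetric] by (simp only: domIff simp_thms)
    then show ?thesis using False by (simp only: part_def if_False)
  next
    case True
    have Qu: "Q (cut Y u) = Q u" using Q True by (simp add: form_on_def)
    then have cu: "cut Y u \<in> dom E"
      using True unfolding Q(1)[symmetric] by (simp only: domIff simp_thms)
    obtain a where a: "\<forall>c. \<forall>u\<in>dom R. \<forall>v\<in>dom R. a (\<lambda>x. c * u x) v = c * a u v"
      "\<forall>u\<in>dom R. the (R u) = a u u" "(\<lambda>x. 0) \<in> dom R"
      using R(1) unfolding quadratic_form_def by blast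
    have "the (R (\<lambda>x. 0)) = a (\<lambda>x. 0) (\<lambda>x. 0)" using a(2,3) by blast
    also have "\<dots> = 0" using a(1)[rule_format, OF a(3) a(3), of 0] by simp
    finally have "the (R (\<lambda>x. 0)) = 0" .
    moreover have "R (cut (- Y) (cut Y u)) = R (cut Y u)"
      using R(2,3) cu unfolding form_on_def by blast
    then have "R (cut Y u) = R (\<lambda>x. 0)" by simp
    ultimately have "the (E (cut Y u)) = the (Q u)" using sum[OF cu] Qu by simp
    moreover have "E (cut Y u) \<noteq> None" using cu by (simp only: domIff simp_thms)
    moreover have "Q u \<noteq> None" using True unfolding Q(1)[symmetric] by (simp only: domIff simp_thms)
    ultimately have "E (cut Y u) = Q u" by (intro option.expand) blast+
    then show ?thesis using True by (simp only: part_def if_True)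
  qed
qed

end

section \<open>The conservative and the dissipative part\<close>

locale dirichlet_with_semigroup = form_with_semigroup + sigma_finite_markov
begin

lemma X_diss_invariant: "invariant_set M T (X_diss M T)"
  using invariant_compl[OF X_cons_invariant space] by (simp add: X_diss_def space Compl_eq_Diff_UNIV)

lemma part_conservative:
  "conservative (restrict_space M (X_cons M T)) (as_form_in_L2_of (X_cons M T) (part E (X_cons M T)))"
  unfolding conservative_def
proof (intro exI conjI allI impI)
  let ?Y = "X_cons M T"
  show "associated_semigroup (restrict_space M ?Y) (as_form_in_L2_of ?Y (part E ?Y)) (\<lambda>t u. T t (cut ?Y u))"
    by (rule part_associated[OF X_cons_invariant])
  fix t :: real assume t: "0 < t"
  show "AE x in restrict_space M ?Y. Linf_extension (restrict_space M ?Y) (\<lambda>t u. T t (cut ?Y u)) t (\<lambda>_. 1) x = 1"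
    using one_restricted[OF X_cons_invariant t] one_on_X_cons[OF t]
    unfolding AE_restrict[OF X_cons_sets] by eventually_elim auto
qed

text \<open>If the extension at integer times were \<open>1\<close> almost everywhere on \<open>X_diss\<close>, this set would be null, as it
consists of the points where \<open>one k\<close> differs from \<open>1\<close> for some \<open>k\<close>.\<close>

lemma part_dissipative:
  assumes pos: "0 < emeasure M (X_diss M T)"
  shows "dissipative (restrict_space M (X_diss M T)) (as_form_in_L2_of (X_diss M T) (part E (X_diss M T)))"
proof -
  let ?Y = "X_diss M T"
  let ?N = "restrict_space M ?Y" and ?T = "\<lambda>t u. T t (cut ?Y u)"
  have Y: "?Y \<in> sets M" using X_diss_invariant by (simp add: invariant_set_def)
  interpret N: sigma_finite_markov ?N ?T
    by (intro sigma_finite_markov.intro markov_L2.intro sigma_finite_markov_axioms.intro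
        restricted_semigroup[OF X_diss_invariant] sigma_finite_measure_restrict_space[OF sigma_finite Y])
  have "\<exists>k::nat. 1 \<le> k \<and> emeasure ?N {x \<in> space ?N. N.one (real k) x < 1} > 0"
  proof (rule ccontr)
    assume "\<not> ?thesis"
    then have null: "emeasure ?N {x \<in> space ?N. N.one (real k) x < 1} = 0" if "1 \<le> k" for k :: nat
      using that by (simp add: not_less)
    have "AE x in M. x \<in> ?Y \<longrightarrow> one (real k) x = 1" if k: "1 \<le> k" for k :: nat
    proof -
      have k0: "0 < real k" using k by simp
      have "{x \<in> space ?N. N.one (real k) x < 1} \<in> sets ?N"
        using N.one_measurable[OF k0] by measurable
      then have "AE x in ?N. \<not> N.one (real k) x < 1"
        using AE_iff_measurable[of "{x \<in> space ?N. N.one (real k) x < 1}" ?N] null[OF k] by simp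
      then show ?thesis
        using one_restricted[OF X_diss_invariant k0] one_unit[OF k0]
        unfolding AE_restrict[OF Y] by eventually_elim auto
    qed
    then have "AE x in M. \<forall>k\<in>{1..}. x \<in> ?Y \<longrightarrow> one (real k) x = 1"
      by (subst AE_ball_countable) auto
    then have "AE x in M. x \<notin> ?Y"
      by eventually_elim (auto simp: X_diss_def X_cons_def)
    then have "?Y \<in> null_sets M" using AE_iff_null_sets[OF Y] by simp
    then show False using pos by auto
  qed
  then obtain k :: nat where "1 \<le> k" "emeasure ?N {x \<in> space ?N. N.one (real k) x < 1} > 0"
    by blast
  then show ?thesis
    unfolding dissipative_def
    using part_associated[OF X_diss_invariant] by (intro exI[of _ ?T] conjI exI[of _ "real k"]) auto
qed

end

theorem theorem4p8:
  fixes M :: "'a::t2_space measure"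
    and E :: "'a form"
    and T :: "real \<Rightarrow> ('a \<Rightarrow> real) \<Rightarrow> ('a \<Rightarrow> real)"
  assumes "radon_measure M" and "sigma_finite_measure M" and "full_support M"
    and "dirichlet_form M E"
    and "associated_semigroup M E T"
  shows "\<exists>!F. case F of (Ec, Ed) \<Rightarrow>
           quadratic_form M Ec \<and> dom Ec = dom E \<and> form_on (X_cons M T) Ec \<and>
           quadratic_form M Ed \<and> dom Ed = dom E \<and> form_on (X_diss M T) Ed \<and>
           wide_dirichlet_form M (as_form_in_L2 M (X_cons M T) Ec) \<and>
           wide_dirichlet_form M (as_form_in_L2 M (X_diss M T) Ed) \<and>
           dirichlet_form (restrict_space M (X_cons M T)) (as_form_in_L2_of (X_cons M T) Ec) \<and>
           dirichlet_form (restrict_space M (X_diss M T)) (as_form_in_L2_of (X_diss M T) Ed) \<and>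
           conservative (restrict_space M (X_cons M T)) (as_form_in_L2_of (X_cons M T) Ec) \<and>
           (emeasure M (X_diss M T) > 0 \<longrightarrow>
              dissipative (restrict_space M (X_diss M T)) (as_form_in_L2_of (X_diss M T) Ed)) \<and>
           (\<forall>u\<in>dom E. the (E u) = the (Ec u) + the (Ed u))"
proof -
  have E: "quadratic_form M E" "closed_form M E" "wide_dirichlet_form M E"
    using assms(4) by (simp_all add: dirichlet_form_def wide_dirichlet_form_def)
  have T: "markov_semigroup M T" using assms(5) by (simp add: associated_semigroup_def)
  have UNIV: "space M = UNIV" using assms(1) by (simp add: radon_measure_def)
  interpret dirichlet_with_semigroup M E T
    by (intro dirichlet_with_semigroup.intro form_with_semigroup.intro sigma_finite_markov.intro
        closed_quadratic_form.intro markov_L2.intro form_with_semigroup_axioms.intro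
        sigma_finite_markov_axioms.intro E T UNIV assms(2,5))
  let ?C = "X_cons M T" and ?D = "X_diss M T"
  note C = X_cons_invariant and D = X_diss_invariant
  have D_eq: "?D = - ?C" by (simp add: X_diss_def space Compl_eq_Diff_UNIV)
  have sum: "the (E u) = the (part E ?C u) + the (part E ?D u)" if "u \<in> dom E" for u
    using form_split[OF C that] that by (simp add: part_def D_eq)
  show ?thesis
  proof (rule ex1I[of _ "(part E ?C, part E ?D)"], unfold prod.case)
    show "quadratic_form M (part E ?C) \<and> dom (part E ?C) = dom E \<and> form_on ?C (part E ?C) \<and>
        quadratic_form M (part E ?D) \<and> dom (part E ?D) = dom E \<and> form_on ?D (part E ?D) \<and>
        wide_dirichlet_form M (as_form_in_L2 M ?C (part E ?C)) \<and>
        wide_dirichlet_form M (as_form_in_L2 M ?D (part E ?D)) \<and>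
        dirichlet_form (restrict_space M ?C) (as_form_in_L2_of ?C (part E ?C)) \<and>
        dirichlet_form (restrict_space M ?D) (as_form_in_L2_of ?D (part E ?D)) \<and>
        conservative (restrict_space M ?C) (as_form_in_L2_of ?C (part E ?C)) \<and>
        (emeasure M ?D > 0 \<longrightarrow> dissipative (restrict_space M ?D) (as_form_in_L2_of ?D (part E ?D))) \<and>
        (\<forall>u\<in>dom E. the (E u) = the (part E ?C u) + the (part E ?D u))"
      by (intro conjI impI ballI part_quadratic part_dom form_on_part part_in_L2_wide_dirichlet
          part_dirichlet part_conservative part_dissipative sum C D E(3) assms(4))
  next
    fix F :: "'a form \<times> 'a form"
    obtain Ec Ed where F: "F = (Ec, Ed)" by (cases F)
    assume "case F of (Ec, Ed) \<Rightarrow>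
           quadratic_form M Ec \<and> dom Ec = dom E \<and> form_on (X_cons M T) Ec \<and>
           quadratic_form M Ed \<and> dom Ed = dom E \<and> form_on (X_diss M T) Ed \<and>
           wide_dirichlet_form M (as_form_in_L2 M (X_cons M T) Ec) \<and>
           wide_dirichlet_form M (as_form_in_L2 M (X_diss M T) Ed) \<and>
           dirichlet_form (restrict_space M (X_cons M T)) (as_form_in_L2_of (X_cons M T) Ec) \<and>
           dirichlet_form (restrict_space M (X_diss M T)) (as_form_in_L2_of (X_diss M T) Ed) \<and>
           conservative (restrict_space M (X_cons M T)) (as_form_in_L2_of (X_cons M T) Ec) \<and>
           (emeasure M (X_diss M T) > 0 \<longrightarrow>
              dissipative (restrict_space M (X_diss M T)) (as_form_in_L2_of (X_diss M T) Ed)) \<and>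
           (\<forall>u\<in>dom E. the (E u) = the (Ec u) + the (Ed u))"
    then have c: "quadratic_form M Ec" "dom Ec = dom E" "form_on ?C Ec"
      and d: "quadratic_form M Ed" "dom Ed = dom E" "form_on ?D Ed"
      and s: "\<And>u. u \<in> dom E \<Longrightarrow> the (E u) = the (Ec u) + the (Ed u)"
      unfolding F prod.case by blast+
    have "Ec = part E ?C"
      by (rule part_unique[OF c(2,3) d(1,2)]) (use d(3) D_eq s in auto)
    moreover have "Ed = part E ?D"
      by (rule part_unique[OF d(2,3) c(1,2)]) (use c(3) D_eq s in auto)
    ultimately show "F = (part E ?C, part E ?D)" by (simp add: F)
  qed
qed

end
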